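(* Let $E$ be a real Banach space, $F$ a real Hilbert space with a Schauder basis $(b_i)_{i\in\mathbb{N}}$ that is both Besselian and Hilbertian, and let $(b_i^* )_{i\in\mathbb N}$ be the biorthogonal functionals. Let $\mathbb{N}=I_0\cup I_1$ with $I_0\cap I_1=\emptyset$, let $G:E\to F$ be of class $C^1$, $g_i:=b_i^*\circ G$ for $i\in\mathbb N$, and $$\mathcal F=\{x\in E\mid g_i(x)=0,\ i\in I_0,\ g_i(x)\le 0,\ i\in I_1\}.$$ Let $x_0\in\mathcal F$ and assume that (i) the Relaxed Constant Rank Constraint Qualification Plus (RCRCQ+) holds for $\mathcal F$ at $x_0$; (ii) for all $d\in\Gamma_{\mathcal F}(x_0)$ and for any function $r:(0,1)\to E$ with $\|r(t)\|t^{-1}\to 0$ as $t\downarrow 0$, there exists $\varepsilon_0>0$ such that $g_i(x_0+td+r(t))\le 0$ for all $i\in I_1\setminus I(x_0,d)$ and all $t\in(0,\varepsilon_0)$, where $I(x_0,d):=\{i\in I(x_0)\mid Dg_i(x_0)d=0\}$. Then the Abadie condition holds: $\Gamma_{\mathcal F}(x_0)=\mathcal T_{\mathcal F}(x_0)$. Moreover, for each $d\in\mathcal T_{\mathcal F}(x_0)$ there is a function $r:(0,1)\to E$ with $\|r(t)\|/t\to 0$ as $t\downarrow 0$ such that, with $J(d):=I_0\cup I(x_0,d)$, for all sufficiently small $t>0$ $$g_i(x_0+td+r(t))=0,\ i\in J(d),\qquad g_\ell(x_0+td+r(t))\le 0,\ \ell\in I_1\setminus J(d).$$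
   Context: Schauder basis of a Banach space $X$: a sequence $(v_i)$ such that every $x\in X$ has a unique expansion $x=\sum_i a_iv_i$ (for finite-dimensional $X$, a linear basis); the biorthogonal functionals $v_i^*\in X^*$ satisfy $v_i^*(v_j)=\delta_{ij}$, $x=\sum_i v_i^*(x)v_i$. A basis $(c_i)$ is Besselian if convergence of $\sum_i\alpha_ic_i$ implies $\sum_i\alpha_i^2<\infty$, and Hilbertian if $\sum_i\alpha_i^2<\infty$ implies convergence of $\sum_i\alpha_ic_i$. It is boundedly-complete if $\sup_N\|\sum_{i\le N}a_iv_i\|<\infty$ implies convergence of $\sum a_iv_i$, and shrinking if $(v_i^* )$ is a basis of $X^*$. $\overline{\operatorname{span}}$ is the norm-closed linear span. Cone: $K=\{y\in F\mid b_i^*(y)=0,\ i\in I_0,\ b_i^*(y)\le 0,\ i\in I_1\}$; thus $\mathcal F=\{x\in E\mid G(x)\in K\}$. Tangent (Bouligand) cone to a set $Q$ at $x\in Q$: $\mathcal T_Q(x)=\{d\mid \exists\, (x_k)\subset Q,\ t_k\downarrow 0,\ x_k\to x,\ (x_k-x)/t_k\to d\}$. Linearized cone: $\Gamma_{\mathcal F}(x)=\{d\in E\mid DG(x)d\in\mathcal T_K(G(x))\}$. Active inequality indices: $I(x)=\{i\in I_1\mid g_i(x)=0\}$. For $J=\{j_1<j_2<\dots\}\subset\mathbb N$: $Y(J)=\{(c_i)_{i\in J}\mid\sum_{i\in J}c_ib_i\text{ converges in }F\}$ with norm $\sup_N\|\sum_{k=1}^Nc_{j_k}b_{j_k}\|$.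 CRC+ (Constant Rank Condition Plus) for $(g_i)_{i\in J}$ at $x_0$ with neighbourhood $V(x_0)$ and index set $J_2\subset J$ means: 1. $(Dg_i(x))_{i\in J_2}$ is a Schauder basis of $\overline{\operatorname{span}}(Dg_i(x),\,i\in J)\subset E^*$ for all $x\in V(x_0)$; 2. for every $x\in V(x_0)$ there is a (linear) topological isomorphism $z_x:\overline{\operatorname{span}}(Dg_i(x),i\in J_2)\to\overline{\operatorname{span}}(Dg_i(x_0),i\in J_2)$ with $z_x(Dg_i(x))=Dg_i(x_0)$, $i\in J_2$; 3. $(Dg_i(x_0))_{i\in J_2}(E)=\{(Dg_i(x_0)e)_{i\in J_2}\mid e\in E\}$ is closed in $Y(J_2)$; 4. $(Dg_i(x_0))_{i\in J_2}$ is a shrinking and boundedly-complete basis of $X_1:=\overline{\operatorname{span}}(Dg_i(x_0),i\in J)$; 5. $(Dg_i(x_0))_{i\in J_2}$ is Besselian for $X_1$; 6. $Dg_i(x_0)^*\in E$ for $i\in J_2$, where $Dg_i(x_0)^*\in X_1^*$ are the functionals biorthogonal to the basis $(Dg_i(x_0))_{i\in J_2}$ of $X_1$; i.e. each $Dg_i(x_0)^*$ is evaluation of elements of $X_1\subset E^*$ at an element of $E$. RCRCQ+ holds for $\mathcal F$ at $x_0$ if there is a neighbourhood $V(x_0)$ such that for every $J$ with $I_0\subset J\subset I_0\cup I(x_0)$ there exists $J_2\subset J$ such that CRC+ holds for $(g_i)_{i\in J}$ at $x_0$ with neighbourhood $V(x_0)$ and index set $J_2$. *)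

theory Defs
  imports "HOL-Analysis.Analysis"
begin

section \<open>Schauder bases\<close>

text \<open>
  A family indexed by a set \<open>J\<close> of naturals (finite or infinite, in increasing order) is
  a function on all naturals of which only the values on \<open>J\<close> matter. A coefficient family
  on \<open>J\<close> is extended by zero, so that the series over \<open>J\<close> is an ordinary series
  whose partial sums are those of the enumerated family, up to repetitions.
\<close>

definition supported_on :: "nat set \<Rightarrow> (nat \<Rightarrow> real) \<Rightarrow> bool" where
  "supported_on J a \<longleftrightarrow> (\<forall>i. i \<notin> J \<longrightarrow> a i = 0)"

definition schauder_basis :: "nat set \<Rightarrow> (nat \<Rightarrow> 'v::real_normed_vector) \<Rightarrow> 'v set \<Rightarrow> bool" where
  "schauder_basis J v X \<longleftrightarrow>
     subspace X \<and> closed X \<and> (\<forall>i\<in>J. v i \<in> X) \<and>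
     (\<forall>x\<in>X. \<exists>!a. supported_on J a \<and> (\<lambda>i. a i *\<^sub>R v i) sums x)"

text \<open>The biorthogonal functionals of a basis of a proper subspace, meaningful on that subspace only.\<close>

definition basis_coeff :: "nat set \<Rightarrow> (nat \<Rightarrow> 'v::real_normed_vector) \<Rightarrow> nat \<Rightarrow> 'v \<Rightarrow> real" where
  "basis_coeff J v i x = (THE a. supported_on J a \<and> (\<lambda>i. a i *\<^sub>R v i) sums x) i"

definition biorthogonal_functionals ::
    "(nat \<Rightarrow> 'v::real_normed_vector) \<Rightarrow> (nat \<Rightarrow> 'v \<Rightarrow>\<^sub>L real) \<Rightarrow> bool" where
  "biorthogonal_functionals v vs \<longleftrightarrow>
     (\<forall>i j. blinfun_apply (vs i) (v j) = (if i = j then 1 else 0)) \<and>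
     (\<forall>x. (\<lambda>i. blinfun_apply (vs i) x *\<^sub>R v i) sums x)"

definition besselian :: "nat set \<Rightarrow> (nat \<Rightarrow> 'v::real_normed_vector) \<Rightarrow> bool" where
  "besselian J v \<longleftrightarrow>
     (\<forall>a. supported_on J a \<longrightarrow> summable (\<lambda>i. a i *\<^sub>R v i) \<longrightarrow> summable (\<lambda>i. (a i)\<^sup>2))"

definition hilbertian :: "nat set \<Rightarrow> (nat \<Rightarrow> 'v::real_normed_vector) \<Rightarrow> bool" where
  "hilbertian J v \<longleftrightarrow>
     (\<forall>a. supported_on J a \<longrightarrow> summable (\<lambda>i. (a i)\<^sup>2) \<longrightarrow> summable (\<lambda>i. a i *\<^sub>R v i))"

definition boundedly_complete :: "nat set \<Rightarrow> (nat \<Rightarrow> 'v::real_normed_vector) \<Rightarrow> bool" where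
  "boundedly_complete J v \<longleftrightarrow>
     (\<forall>a. supported_on J a \<longrightarrow> bounded (range (\<lambda>N. \<Sum>i<N. a i *\<^sub>R v i)) \<longrightarrow>
          summable (\<lambda>i. a i *\<^sub>R v i))"

text \<open>
  Elements of the dual of a subspace \<open>X\<close> are represented by functions on the ambient space;
  two functions that agree on \<open>X\<close> represent the same functional.
\<close>

definition linear_on_subspace :: "'v::real_vector set \<Rightarrow> ('v \<Rightarrow> 'w::real_vector) \<Rightarrow> bool" where
  "linear_on_subspace X f \<longleftrightarrow>
     (\<forall>x\<in>X. \<forall>y\<in>X. f (x + y) = f x + f y) \<and> (\<forall>c. \<forall>x\<in>X. f (c *\<^sub>R x) = c *\<^sub>R f x)"

definition dual_functionals :: "'v::real_normed_vector set \<Rightarrow> ('v \<Rightarrow> real) set" where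
  "dual_functionals X =
     {f. linear_on_subspace X f \<and> (\<exists>B. \<forall>x\<in>X. \<bar>f x\<bar> \<le> B * norm x)}"

definition dual_norm :: "'v::real_normed_vector set \<Rightarrow> ('v \<Rightarrow> real) \<Rightarrow> real" where
  "dual_norm X f = (SUP x\<in>X \<inter> cball 0 1. \<bar>f x\<bar>)"

definition shrinking :: "nat set \<Rightarrow> (nat \<Rightarrow> 'v::real_normed_vector) \<Rightarrow> 'v set \<Rightarrow> bool" where
  "shrinking J v X \<longleftrightarrow>
     (\<forall>i\<in>J. basis_coeff J v i \<in> dual_functionals X) \<and>
     (\<forall>f\<in>dual_functionals X. \<exists>!a. supported_on J a \<and>
        (\<lambda>N. dual_norm X (\<lambda>x. f x - (\<Sum>i<N. a i * basis_coeff J v i x))) \<longlonglongrightarrow> 0)"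

section \<open>The sequence space \<open>Y(J)\<close>\<close>

definition seq_space :: "(nat \<Rightarrow> 'v::real_normed_vector) \<Rightarrow> nat set \<Rightarrow> (nat \<Rightarrow> real) set" where
  "seq_space b J = {c. supported_on J c \<and> summable (\<lambda>i. c i *\<^sub>R b i)}"

definition seq_norm :: "(nat \<Rightarrow> 'v::real_normed_vector) \<Rightarrow> (nat \<Rightarrow> real) \<Rightarrow> real" where
  "seq_norm b c = (SUP N. norm (\<Sum>i<N. c i *\<^sub>R b i))"

definition closed_in_seq_space ::
    "(nat \<Rightarrow> 'v::real_normed_vector) \<Rightarrow> nat set \<Rightarrow> (nat \<Rightarrow> real) set \<Rightarrow> bool" where
  "closed_in_seq_space b J S \<longleftrightarrow>
     closedin (Metric_space.mtopology (seq_space b J) (\<lambda>c d. seq_norm b (\<lambda>i. c i - d i))) S"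

section \<open>Derivatives\<close>

text \<open>The Frechet derivative as an element of the space of bounded operators; \<open>Blinfun\<close> is
  meaningful where the function is differentiable.\<close>

definition fderiv :: "('a::real_normed_vector \<Rightarrow> 'b::real_normed_vector) \<Rightarrow> 'a \<Rightarrow> 'a \<Rightarrow>\<^sub>L 'b" where
  "fderiv f x = Blinfun (frechet_derivative f (at x))"

definition class_C1 :: "('a::real_normed_vector \<Rightarrow> 'b::real_normed_vector) \<Rightarrow> bool" where
  "class_C1 f \<longleftrightarrow> (\<forall>x. f differentiable (at x)) \<and> continuous_on UNIV (fderiv f)"

section \<open>Feasible set and cones\<close>

definition feasible_set :: "(nat \<Rightarrow> 'a \<Rightarrow> real) \<Rightarrow> nat set \<Rightarrow> nat set \<Rightarrow> 'a set" where
  "feasible_set g I0 I1 = {x. (\<forall>i\<in>I0. g i x = 0) \<and> (\<forall>i\<in>I1. g i x \<le> 0)}"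

definition cone_K ::
    "(nat \<Rightarrow> 'b::real_normed_vector \<Rightarrow>\<^sub>L real) \<Rightarrow> nat set \<Rightarrow> nat set \<Rightarrow> 'b set" where
  "cone_K bs I0 I1 =
     {y. (\<forall>i\<in>I0. blinfun_apply (bs i) y = 0) \<and> (\<forall>i\<in>I1. blinfun_apply (bs i) y \<le> 0)}"

definition tangent_cone :: "'v::real_normed_vector set \<Rightarrow> 'v \<Rightarrow> 'v set" where
  "tangent_cone Q x =
     {d. \<exists>(xs :: nat \<Rightarrow> 'v) (t :: nat \<Rightarrow> real).
           (\<forall>k. xs k \<in> Q) \<and> filterlim t (at_right 0) sequentially \<and> (\<forall>k. t k > 0) \<and>
           xs \<longlonglongrightarrow> x \<and> (\<lambda>k. (xs k - x) /\<^sub>R t k) \<longlonglongrightarrow> d}"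

definition linearized_cone ::
    "('a::real_normed_vector \<Rightarrow> 'b::real_normed_vector) \<Rightarrow> 'b set \<Rightarrow> 'a \<Rightarrow> 'a set" where
  "linearized_cone G K x = {d. blinfun_apply (fderiv G x) d \<in> tangent_cone K (G x)}"

definition active :: "(nat \<Rightarrow> 'a \<Rightarrow> real) \<Rightarrow> nat set \<Rightarrow> 'a \<Rightarrow> nat set" where
  "active g I1 x = {i\<in>I1. g i x = 0}"

definition active_dir ::
    "(nat \<Rightarrow> 'a::real_normed_vector \<Rightarrow> real) \<Rightarrow> nat set \<Rightarrow> 'a \<Rightarrow> 'a \<Rightarrow> nat set" where
  "active_dir g I1 x d = {i\<in>active g I1 x. blinfun_apply (fderiv (g i) x) d = 0}"

section \<open>Constant rank conditions\<close>

definition grad_span ::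
    "(nat \<Rightarrow> 'a::real_normed_vector \<Rightarrow> real) \<Rightarrow> nat set \<Rightarrow> 'a \<Rightarrow> ('a \<Rightarrow>\<^sub>L real) set" where
  "grad_span g J x = closure (span ((\<lambda>i. fderiv (g i) x) ` J))"

definition CRC_plus ::
    "(nat \<Rightarrow> 'b::real_normed_vector) \<Rightarrow> (nat \<Rightarrow> 'a::real_normed_vector \<Rightarrow> real) \<Rightarrow>
     'a \<Rightarrow> 'a set \<Rightarrow> nat set \<Rightarrow> nat set \<Rightarrow> bool" where
  "CRC_plus b g x0 V J J2 \<longleftrightarrow>
     (\<forall>x\<in>V. schauder_basis J2 (\<lambda>i. fderiv (g i) x) (grad_span g J x)) \<and>
     (\<forall>x\<in>V. \<exists>z z'. homeomorphism (grad_span g J2 x) (grad_span g J2 x0) z z' \<and>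
         linear_on_subspace (grad_span g J2 x) z \<and>
         (\<forall>i\<in>J2. z (fderiv (g i) x) = fderiv (g i) x0)) \<and>
     closed_in_seq_space b J2
       (range (\<lambda>e i. if i \<in> J2 then blinfun_apply (fderiv (g i) x0) e else 0)) \<and>
     shrinking J2 (\<lambda>i. fderiv (g i) x0) (grad_span g J x0) \<and>
     boundedly_complete J2 (\<lambda>i. fderiv (g i) x0) \<and>
     besselian J2 (\<lambda>i. fderiv (g i) x0) \<and>
     (\<forall>i\<in>J2. \<exists>e. \<forall>\<phi>\<in>grad_span g J x0.
         basis_coeff J2 (\<lambda>j. fderiv (g j) x0) i \<phi> = blinfun_apply \<phi> e)"

definition RCRCQ_plus ::
    "(nat \<Rightarrow> 'b::real_normed_vector) \<Rightarrow> (nat \<Rightarrow> 'a::real_normed_vector \<Rightarrow> real) \<Rightarrow>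
     nat set \<Rightarrow> nat set \<Rightarrow> 'a \<Rightarrow> bool" where
  "RCRCQ_plus b g I0 I1 x0 \<longleftrightarrow>
     (\<exists>V. x0 \<in> interior V \<and>
        (\<forall>J. I0 \<subseteq> J \<longrightarrow> J \<subseteq> I0 \<union> active g I1 x0 \<longrightarrow>
             (\<exists>J2\<subseteq>J. CRC_plus b g x0 V J J2)))"

end

theory Submission
  imports Defs
begin

text \<open>
  That a tangent direction \<open>d\<close> of the feasible set belongs to the linearized cone is differentiability of \<open>G\<close>
  (\<open>hadamard_derivative\<close>). Conversely, let \<open>d\<close> be in the linearized cone and let \<open>J\<close> consist of the equality
  constraints and of the active inequality constraints whose derivative vanishes at \<open>d\<close>. Then all the constraints
  in \<open>J\<close> have derivative zero in the direction \<open>d\<close>. It suffices to find \<open>r(t) = o(t)\<close> such that they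
  vanish at \<open>x0 + t d + r(t)\<close>, since for that \<open>r\<close> the other inequalities hold by hypothesis.
  
  The constraint qualification provides \<open>J2 \<subseteq> J\<close> for which the gradients form a basis of the closed span of the
  gradients over \<open>J\<close>, at every point near \<open>x0\<close>, and a Besselian one at \<open>x0\<close> with coefficient functionals
  that are evaluations. From the latter two properties the derivative at \<open>x0\<close> of the constraints in
  \<open>J2\<close>, as a map into the subspace with coefficients supported on \<open>J2\<close>, is onto: its adjoint
  is bounded below (\<open>besselian_rows_lower_bound\<close>), and descent along almost norming vectors solves the linear
  equation (\<open>besselian_rows_right_inverse\<close>). Hence the constraints in \<open>J2\<close> can be solved near \<open>x0\<close>
  with a correction proportional to their defect (\<open>lyusternik_graves\<close>), which on the line
  \<open>x0 + t d\<close> is \<open>o(t)\<close>.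
  
  The constraints in \<open>J - J2\<close> are functions of those in \<open>J2\<close> near \<open>x0\<close>, because their derivatives vanish on the
  kernel of the derivatives of the latter at every nearby point (\<open>constant_rank_fibre\<close>). The usual proof of
  this fact straightens the fibres by means of a complement of the kernel. Such a complement need not exist here:
  a surjection from \<open>\<ell>\<^sup>1\<close> onto \<open>\<ell>\<^sup>2\<close>, whose kernel is not complemented, is a possible derivative.
  The argument given below instead walks along a fibre by infinitesimal steps in kernel directions.
  
  All the limiting procedures, that is the solution of linear and nonlinear equations and the walk along a fibre,
  are instances of one principle on complete metric spaces (\<open>maximal_point_of_ordering\<close>).
\<close>

section \<open>Descent in complete metric spaces\<close>

text \<open>
  This is the ordering principle behind the variational principle of Ekeland. Replacing a point by a
  larger one costs at least its distance in terms of \<open>f\<close>, and \<open>f\<close> cannot fall below zero, so a chain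
  whose steps are nearly as good as possible is a Cauchy sequence, and nothing lies above its limit.
  It is used to run infinitesimal steps to their end when no compactness is available.
\<close>

lemma maximal_point_of_ordering:
  fixes R :: "'a::complete_space \<Rightarrow> 'a \<Rightarrow> bool" and f :: "'a \<Rightarrow> real"
  assumes refl: "\<And>x. R x x"
    and trans: "\<And>x y z. R x y \<Longrightarrow> R y z \<Longrightarrow> R x z"
    and closed: "\<And>x. closed {y. R x y}"
    and dist_le: "\<And>x y. R x y \<Longrightarrow> dist x y \<le> f x - f y"
    and nonneg: "\<And>x. 0 \<le> f x"
  obtains y where "R x y" "\<And>z. R y z \<Longrightarrow> z = y"
proof -
  \<comment> \<open>A step \<open>x \<mapsto> y\<close> that leaves at most \<open>(1/2)^n\<close> of decrease of \<open>f\<close> to any other point above \<open>x\<close>.\<close>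
  have "\<exists>y. R x y \<and> (\<forall>z. R x z \<longrightarrow> f y \<le> f z + (1/2)^n)" for x and n :: nat
  proof -
    define m where "m = Inf (f ` {y. R x y})"
    have bdd: "bdd_below (f ` {y. R x y})"
      using nonneg by (intro bdd_belowI[of _ 0]) auto
    have "m < m + (1/2)^n"
      by simp
    then obtain y where y: "R x y" "f y < m + (1/2)^n"
      using cInf_lessD[of "f ` {y. R x y}" "m + (1/2)^n"] refl[of x] unfolding m_def by auto
    have "m \<le> f z" if "R x z" for z
      unfolding m_def using that by (intro cInf_lower bdd) auto
    with y show ?thesis
      by (smt (verit))
  qed
  then obtain nxt where nxt: "\<And>x n. R x (nxt x n)"
    "\<And>x n z. R x z \<Longrightarrow> f (nxt x n) \<le> f z + (1/2)^n"
    by metis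
  define s where "s = rec_nat x (\<lambda>n y. nxt y n)"
  have s0: "s 0 = x" and sS: "s (Suc n) = nxt (s n) n" for n
    by (simp_all add: s_def)
  have mono: "R (s m) (s n)" if "m \<le> n" for m n
    using that
  proof (induction n rule: dec_induct)
    case base
    show ?case by (rule refl)
  next
    case (step n)
    then show ?case using trans nxt(1) sS by metis
  qed
  have small: "dist (s (Suc n)) z \<le> (1/2)^n" if "R (s (Suc n)) z" for n z
  proof -
    have "R (s n) z"
      using that trans mono[of n "Suc n"] by simp
    then show ?thesis
      using dist_le[OF that] nxt(2)[of "s n" z n] sS by simp
  qed
  have pow: "(\<lambda>n. (1/2::real)^n) \<longlonglongrightarrow> 0"
    by (rule LIMSEQ_power_zero) simp
  have "Cauchy s"
  proof (rule metric_CauchyI)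
    fix e :: real assume "e > 0"
    then obtain n where n: "(1/2::real)^n < e / 2"
      using pow order_tendstoD(2)[of _ 0 sequentially "e/2"] 
      by (metis eventually_sequentially half_gt_zero order_refl)
    have "dist (s i) (s j) < e" if "i \<ge> Suc n" "j \<ge> Suc n" for i j
      using small[OF mono[OF that(1)]] small[OF mono[OF that(2)]] n
        dist_triangle3[of "s i" "s j" "s (Suc n)"] by linarith
    then show "\<exists>M. \<forall>m\<ge>M. \<forall>n\<ge>M. dist (s m) (s n) < e"
      by blast
  qed
  then obtain y where y: "s \<longlonglongrightarrow> y"
    using Cauchy_convergent convergent_def by blast
  have sy: "R (s n) y" for n
  proof -
    have "\<forall>\<^sub>F k in sequentially. s k \<in> {y. R (s n) y}"
      using mono by (auto simp: eventually_sequentially)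
    then show ?thesis
      using Lim_in_closed_set[OF closed _ _ y] by auto
  qed
  have "z = y" if "R y z" for z
  proof -
    have "(\<lambda>n. dist (s (Suc n)) z) \<longlonglongrightarrow> 0"
      using small trans[OF sy that]
      by (intro tendsto_sandwich[OF _ _ tendsto_const pow]) auto
    then have "(\<lambda>n. s (Suc n)) \<longlonglongrightarrow> z"
      using tendsto_dist_iff by blast
    then show ?thesis
      using LIMSEQ_unique y LIMSEQ_Suc by blast
  qed
  then show thesis
    using that[of y] sy[of 0] s0 by auto
qed

text \<open>
  A step from \<open>q\<close> that shrinks \<open>h\<close> by the factor \<open>\<theta>\<close> and has length at most \<open>C * h q\<close> buys its length at the
  rate \<open>C / (1 - \<theta>)\<close> in the decrease of \<open>h\<close>. A point that is maximal for the order "reachable at this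
  rate" admits no such step of positive gain, hence is a zero.
\<close>

lemma root_by_descent:
  fixes h :: "'a::complete_space \<Rightarrow> real"
  assumes cont: "continuous_on UNIV h" and nonneg: "\<And>q. 0 \<le> h q"
    and \<theta>: "\<theta> < 1" and C: "0 \<le> C"
    and step: "\<And>q. dist p q \<le> C / (1 - \<theta>) * (h p - h q) \<Longrightarrow>
      \<exists>q'. dist q q' \<le> C * h q \<and> h q' \<le> \<theta> * h q"
  obtains q where "h q = 0" "dist p q \<le> C / (1 - \<theta>) * h p"
proof -
  define K where "K = C / (1 - \<theta>)"
  have K: "0 \<le> K" "K * (1 - \<theta>) = C"
    using C \<theta> by (auto simp: K_def)
  define R where "R x y \<longleftrightarrow> dist x y \<le> K * h x - K * h y" for x y
  have cl: "closed {y. R x y}" for x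
    unfolding R_def
    by (intro closed_Collect_le continuous_intros cont)
  have tr: "R x z" if "R x y" "R y z" for x y z
    using that dist_triangle[of x z y] unfolding R_def by linarith
  obtain q where q: "R p q" "\<And>z. R q z \<Longrightarrow> z = q"
    by (rule maximal_point_of_ordering[of R "\<lambda>x. K * h x" p])
      (use cl tr K nonneg in \<open>auto simp: R_def\<close>)
  obtain q' where q': "dist q q' \<le> C * h q" "h q' \<le> \<theta> * h q"
    using step[of q] q(1) unfolding R_def K_def right_diff_distrib by blast
  have "K * h q' \<le> K * (\<theta> * h q)"
    using q'(2) K(1) by (rule mult_left_mono)
  moreover have "C * h q = K * h q - K * (\<theta> * h q)"
    by (simp add: K(2)[symmetric] algebra_simps)
  ultimately have "R q q'"
    using q'(1) unfolding R_def by linarith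
  then have "(1 - \<theta>) * h q \<le> 0"
    using q(2) q'(2) by (force simp: algebra_simps)
  then have "h q = 0"
    using \<theta> nonneg[of q] by (simp add: mult_le_0_iff)
  then show thesis
    using that[of q] q(1) unfolding R_def K_def by simp
qed

section \<open>Uniform boundedness\<close>

text \<open>
  The principle of uniform boundedness, for seminorms on a closed subspace. By the theorem of Baire a set on
  which all the seminorms are bounded by one constant contains a ball of the subspace, and
  subadditivity moves that ball to the origin.
\<close>

lemma uniform_boundedness:
  fixes X :: "'v::{real_normed_vector,complete_space} set" and p :: "nat \<Rightarrow> 'v \<Rightarrow> real"
  assumes "closed X" and sub: "subspace X"
    and cont: "\<And>n. continuous_on UNIV (p n)"
    and triangle: "\<And>n x y. p n (x + y) \<le> p n x + p n y"
    and scale: "\<And>n c x. p n (c *\<^sub>R x) = \<bar>c\<bar> * p n x"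
    and pointwise: "\<And>x. x \<in> X \<Longrightarrow> \<exists>B. \<forall>n. p n x \<le> B"
  obtains C where "0 < C" "\<And>n x. x \<in> X \<Longrightarrow> p n x \<le> C * norm x"
proof -
  define T where "T m = {x \<in> X. \<forall>n. p n x \<le> real m}" for m
  have cl: "closed (T m)" for m
  proof -
    have "T m = X \<inter> (\<Inter>n. {x. p n x \<le> real m})"
      by (auto simp: T_def)
    then show ?thesis
      using \<open>closed X\<close> by (auto intro!: closed_Int closed_INT closed_Collect_le cont)
  qed
  have TX: "T m \<subseteq> X" for m
    by (auto simp: T_def)
  have "\<Union>(range T) = X"
  proof -
    have "\<exists>m. x \<in> T m" if x: "x \<in> X" for x
    proof -
      obtain B where B: "\<forall>n. p n x \<le> B"
        using pointwise[OF x] by blast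
      obtain m where "B \<le> real m"
        using real_arch_simple by blast
      with B x show ?thesis
        unfolding T_def by (auto intro: order_trans)
    qed
    then show ?thesis
      using TX by blast
  qed
  have "completely_metrizable_space (top_of_set X)"
    using completely_metrizable_space_closedin[OF completely_metrizable_space_euclidean, of X]
      \<open>closed X\<close> by auto
  then have "top_of_set X interior_of \<Union>(range T) = {}"
    if "\<And>m. top_of_set X interior_of (T m) = {}"
    using that closed_subset[OF TX cl] by (intro Baire_category_alt) auto
  moreover have "top_of_set X interior_of \<Union>(range T) = X"
    using interior_of_topspace[of "top_of_set X"] \<open>\<Union>(range T) = X\<close> by simp
  moreover have "X \<noteq> {}"
    using sub subspace_0 by blast
  ultimately obtain m x0 where "x0 \<in> top_of_set X interior_of (T m)"
    by (metis all_not_in_conv)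
  then obtain U where U: "open U" "x0 \<in> U" "X \<inter> U \<subseteq> T m" "x0 \<in> X"
    unfolding interior_of_def openin_open by auto
  obtain r where r: "r > 0" "ball x0 r \<subseteq> U"
    using U openE by blast
  have x0T: "x0 \<in> T m"
    using U by blast
  define C where "C = 4 * (real m + 1) / r"
  have "p n x \<le> C * norm x" if x: "x \<in> X" for n x
  proof (cases "x = 0")
    case True
    then show ?thesis
      using scale[of n 0 0] by simp
  next
    case False
    define c where "c = r / (2 * norm x)"
    have c: "c > 0"
      using False r by (simp add: c_def)
    have "x0 + c *\<^sub>R x \<in> X"
      using x U sub by (simp add: subspace_add subspace_scale)
    moreover have "x0 + c *\<^sub>R x \<in> ball x0 r"
      using False r by (simp add: dist_norm c_def)
    ultimately have "x0 + c *\<^sub>R x \<in> T m"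
      using r(2) U(3) by blast
    then have "p n (x0 + c *\<^sub>R x) \<le> m"
      by (simp add: T_def)
    moreover have "p n (- x0) \<le> m"
      using scale[of n "-1" x0] x0T by (auto simp: T_def)
    moreover have "p n (c *\<^sub>R x) \<le> p n (x0 + c *\<^sub>R x) + p n (- x0)"
      using triangle[of n "x0 + c *\<^sub>R x" "- x0"] by simp
    ultimately have "c * p n x \<le> 2 * (real m + 1)"
      using scale[of n c x] c by simp
    then have "p n x \<le> 2 * (real m + 1) / c"
      using c by (simp add: field_simps)
    also have "\<dots> = C * norm x"
      using False r by (simp add: C_def c_def field_simps)
    finally show ?thesis .
  qed
  moreover have "C > 0"
    using r by (simp add: C_def)
  ultimately show thesis
    using that by blast
qed

section \<open>Nonlinear equations and constant rank\<close>

text \<open>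
  The iteration of Newton with a fixed linear map: if \<open>H\<close> differs from \<open>L\<close> by a map with a small Lipschitz
  constant, correcting by a preimage of the residual under \<open>L\<close> halves the residual. The right inverse of
  \<open>L\<close> is only required to be bounded; it may be neither linear nor continuous, so that the kernel of
  \<open>L\<close> need not have a closed complement. The subspace \<open>W\<close> allows an \<open>L\<close> that is not onto.
\<close>

lemma linear_approximation_root:
  fixes H :: "'a::{real_normed_vector,complete_space} \<Rightarrow> 'b::real_normed_vector"
  assumes cont: "continuous_on UNIV H"
    and W: "subspace W" and HW: "\<And>x. H x - w \<in> W"
    and right_inv: "\<And>y. y \<in> W \<Longrightarrow> \<exists>v. blinfun_apply L v = y \<and> norm v \<le> C * norm y"
    and C: "0 \<le> C"
    and near: "\<And>x y. x \<in> S \<Longrightarrow> y \<in> S \<Longrightarrow> norm (H y - H x - L (y - x)) \<le> \<eta> * norm (y - x)"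
    and \<eta>: "C * \<eta> \<le> 1 / 2" "0 \<le> \<eta>"
    and S: "cball p (2 * C * norm (H p - w)) \<subseteq> S"
  obtains q where "H q = w" "norm (q - p) \<le> 2 * C * norm (H p - w)"
proof -
  define h where "h q = norm (H q - w)" for q
  have step: "\<exists>q'. dist q q' \<le> C * h q \<and> h q' \<le> 1/2 * h q"
    if q: "dist p q \<le> C / (1 - 1/2) * (h p - h q)" for q
  proof -
    have pq: "dist p q \<le> 2 * C * h p - 2 * C * h q"
      using q by (simp add: algebra_simps)
    have "- (H q - w) \<in> W"
      using W HW subspace_neg by blast
    then obtain u where u: "L u = - (H q - w)" "norm u \<le> C * h q"
      using right_inv[of "- (H q - w)"] unfolding h_def norm_minus_cancel by blast
    have Ch: "0 \<le> C * h q"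
      using C by (simp add: h_def)
    have "dist p (q + u) \<le> dist p q + norm u"
      using dist_triangle[of p "q + u" q] by (simp add: dist_norm)
    then have "q \<in> S" "q + u \<in> S"
      using S pq u(2) Ch unfolding h_def[symmetric] by (auto simp: mem_cball subset_iff)
    then have "norm (H (q + u) - H q - L u) \<le> \<eta> * norm u"
      using near[of q "q + u"] by simp
    also have "\<dots> \<le> \<eta> * (C * h q)"
      using u(2) \<eta> by (simp add: mult_left_mono)
    also have "\<dots> \<le> 1/2 * h q"
      using mult_right_mono[OF \<eta>(1), of "h q"] by (simp add: h_def mult_ac)
    finally have "h (q + u) \<le> 1/2 * h q"
      by (simp add: h_def u(1))
    then show ?thesis
      using u(2) by (intro exI[of _ "q + u"]) (simp add: dist_norm)
  qed
  have hcont: "continuous_on UNIV h"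
    unfolding h_def by (intro continuous_intros cont)
  have hnn: "0 \<le> h q" for q
    by (simp add: h_def)
  obtain q where "h q = 0" "dist p q \<le> C / (1 - 1/2) * h p"
    by (rule root_by_descent[of h "1/2" C p, OF hcont hnn _ C step]) auto
  then show thesis
    using that[of q] by (simp add: h_def dist_norm norm_minus_commute)
qed

lemma right_inverse_perturbation:
  fixes A B :: "'a::{real_normed_vector,complete_space} \<Rightarrow>\<^sub>L 'b::real_normed_vector"
  assumes W: "subspace W" and BW: "\<And>v. B v \<in> W"
    and right_inv: "\<And>y. y \<in> W \<Longrightarrow> \<exists>v. A v = y \<and> norm v \<le> C * norm y"
    and C: "0 \<le> C" and close: "C * norm (B - A) \<le> 1 / 2"
    and w: "w \<in> W"
  shows "\<exists>v. B v = w \<and> norm v \<le> 2 * C * norm w"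
proof -
  have near: "norm (B y - B x - A (y - x)) \<le> norm (B - A) * norm (y - x)" for x y
    using norm_blinfun[of "B - A" "y - x"] by (simp add: blinfun.bilinear_simps algebra_simps)
  obtain q where "B q = w" "norm (q - 0) \<le> 2 * C * norm (B 0 - w)"
    by (rule linear_approximation_root[of "blinfun_apply B" W w A C UNIV "norm (B - A)" 0,
          OF _ W _ right_inv C _ close])
      (use near in \<open>auto intro!: continuous_intros subspace_diff W BW w\<close>)
  then show ?thesis
    by auto
qed

lemma C1_strict_differentiability:
  fixes H :: "'a::real_normed_vector \<Rightarrow> 'b::real_normed_vector" and H' :: "'a \<Rightarrow> 'a \<Rightarrow>\<^sub>L 'b"
  assumes deriv: "\<And>x. (H has_derivative blinfun_apply (H' x)) (at x)"
    and cont: "isCont H' x0" and "0 < \<eta>"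
  obtains \<rho> where "0 < \<rho>" "\<And>x. x \<in> ball x0 \<rho> \<Longrightarrow> norm (H' x - H' x0) \<le> \<eta>"
    "\<And>x y. x \<in> ball x0 \<rho> \<Longrightarrow> y \<in> ball x0 \<rho> \<Longrightarrow>
      norm (H y - H x - H' x0 (y - x)) \<le> \<eta> * norm (y - x)"
proof -
  obtain \<rho> where \<rho>: "\<rho> > 0" "\<And>x. dist x x0 < \<rho> \<Longrightarrow> dist (H' x) (H' x0) < \<eta>"
    using cont \<open>0 < \<eta>\<close> unfolding continuous_at_eps_delta by meson
  have bound: "norm (H' x - H' x0) \<le> \<eta>" if "x \<in> ball x0 \<rho>" for x
    using \<rho>(2)[of x] that by (simp add: dist_norm norm_minus_commute)
  have "norm (H y - H x - H' x0 (y - x)) \<le> \<eta> * norm (y - x)"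
    if "x \<in> ball x0 \<rho>" "y \<in> ball x0 \<rho>" for x y
  proof -
    have "norm (H y - H x - H' x0 (y - x)) \<le> norm (y - x) * \<eta>"
    proof (rule differentiable_bound_linearization[where S = "ball x0 \<rho>"
          and f' = "\<lambda>x. blinfun_apply (H' x)"])
      show "x + t *\<^sub>R (y - x) \<in> ball x0 \<rho>" if "t \<in> {0..1}" for t
      proof -
        have "(1 - t) *\<^sub>R x + t *\<^sub>R y \<in> ball x0 \<rho>"
          using that \<open>x \<in> ball x0 \<rho>\<close> \<open>y \<in> ball x0 \<rho>\<close>
          by (intro convexD convex_ball) auto
        then show ?thesis
          by (simp add: algebra_simps)
      qed
      show "onorm (blinfun_apply (H' z) - blinfun_apply (H' x0)) \<le> \<eta>" if "z \<in> ball x0 \<rho>" for z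
        using bound[OF that] by (simp add: norm_blinfun.rep_eq minus_blinfun.rep_eq fun_diff_def)
    qed (use deriv \<rho> in \<open>auto intro: has_derivative_at_withinI\<close>)
    then show ?thesis
      by (simp add: mult.commute)
  qed
  with \<rho>(1) bound show thesis
    using that by blast
qed

text \<open>
  The fibre of \<open>H\<close> through \<open>x0\<close> comes as close to any nearby \<open>p\<close> as the defect \<open>H p - H x0\<close> permits. For a
  \<open>p\<close> on a line tangent to the fibre the defect is of smaller order than the parameter, which is how
  a tangent direction becomes a curve.
\<close>

lemma lyusternik_graves:
  fixes H :: "'a::{real_normed_vector,complete_space} \<Rightarrow> 'b::real_normed_vector"
    and H' :: "'a \<Rightarrow> 'a \<Rightarrow>\<^sub>L 'b"
  assumes deriv: "\<And>x. (H has_derivative blinfun_apply (H' x)) (at x)"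
    and cont: "isCont H' x0"
    and W: "subspace W" and HW: "\<And>x. H x \<in> W"
    and C: "0 \<le> C"
    and right_inv: "\<And>y. y \<in> W \<Longrightarrow> \<exists>v. H' x0 v = y \<and> norm v \<le> C * norm y"
  obtains \<rho> K where "0 < \<rho>" "0 \<le> K"
    "\<And>p. p \<in> ball x0 \<rho> \<Longrightarrow> \<exists>q. H q = H x0 \<and> norm (q - p) \<le> K * norm (H p - H x0)"
proof -
  define \<eta> where "\<eta> = 1 / (2 * (C + 1))"
  have \<eta>: "0 < \<eta>" "C * \<eta> \<le> 1 / 2"
    using C by (auto simp: \<eta>_def field_simps)
  obtain \<rho> where \<rho>: "0 < \<rho>"
    "\<And>x y. x \<in> ball x0 \<rho> \<Longrightarrow> y \<in> ball x0 \<rho> \<Longrightarrow>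
      norm (H y - H x - H' x0 (y - x)) \<le> \<eta> * norm (y - x)"
    using C1_strict_differentiability[OF deriv cont \<eta>(1)] by metis
  have contH: "isCont H x" for x
    using deriv has_derivative_continuous by blast
  have "isCont (\<lambda>p. 2 * C * norm (H p - H x0)) x0"
    by (intro continuous_intros contH)
  then obtain \<delta> where \<delta>: "0 < \<delta>"
    "\<And>p. dist p x0 < \<delta> \<Longrightarrow> dist (2 * C * norm (H p - H x0)) (2 * C * norm (H x0 - H x0)) < \<rho> / 2"
    using \<open>0 < \<rho>\<close> unfolding continuous_at_eps_delta by (meson half_gt_zero)
  have "\<exists>q. H q = H x0 \<and> norm (q - p) \<le> 2 * C * norm (H p - H x0)"
    if p: "p \<in> ball x0 (min \<delta> (\<rho> / 2))" for p
  proof -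
    have px: "dist p x0 < \<delta>" "dist x0 p < \<rho> / 2"
      using p by (simp_all add: dist_commute)
    have small: "2 * C * norm (H p - H x0) < \<rho> / 2"
      using \<delta>(2)[OF px(1)] by (simp add: dist_real_def)
    have sub: "cball p (2 * C * norm (H p - H x0)) \<subseteq> ball x0 \<rho>"
    proof
      fix z assume "z \<in> cball p (2 * C * norm (H p - H x0))"
      then show "z \<in> ball x0 \<rho>"
        using small px(2) dist_triangle[of x0 z p] by simp
    qed
    have "continuous_on UNIV H"
      using contH by (simp add: continuous_at_imp_continuous_on)
    then obtain q where "H q = H x0" "norm (q - p) \<le> 2 * C * norm (H p - H x0)"
      by (rule linear_approximation_root[OF _ W subspace_diff[OF W HW HW] right_inv C \<rho>(2) \<eta>(2) _ sub])
        (use \<eta>(1) in auto)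
    then show ?thesis
      by blast
  qed
  then show thesis
    using that[of "min \<delta> (\<rho> / 2)" "2 * C"] \<delta>(1) \<rho>(1) C by auto
qed

text \<open>
  The part of the constant rank theorem that survives without a complement of the kernel: if the kernel of
  \<open>P \<circ> \<Phi>'\<close> is contained in that of \<open>\<Phi>'\<close> at all points near \<open>x0\<close>, then \<open>\<Phi>\<close> is constant on the fibre of
  \<open>P \<circ> \<Phi>\<close> near \<open>x0\<close>.
  
  One would like to join \<open>x0\<close> to a point \<open>x\<close> of the fibre by a path inside it, along which \<open>\<Phi>\<close> has
  derivative zero. Instead, one walks from \<open>x0\<close> towards \<open>x\<close> in short steps in kernel directions. A
  step from \<open>q\<close> can be taken close to \<open>x - q\<close> as long as \<open>P (\<Phi> q)\<close> differs from \<open>P (\<Phi> x)\<close> by much less than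
  the distance of \<open>q\<close> from \<open>x\<close>, and a short enough step changes \<open>\<Phi>\<close> by at most \<open>\<epsilon>\<close> times the
  distance gained. The ordering principle yields a point where the walk cannot be continued; by what was said
  it has come within a multiple of \<open>\<epsilon>\<close> of \<open>x\<close>, and \<open>\<Phi>\<close> has changed by a multiple of \<open>\<epsilon>\<close>. Then let \<open>\<epsilon>\<close> tend to zero.
\<close>

lemma constant_rank_fibre:
  fixes \<Phi> :: "'a::{real_normed_vector,complete_space} \<Rightarrow> 'b::real_normed_vector"
    and \<Phi>' :: "'a \<Rightarrow> 'a \<Rightarrow>\<^sub>L 'b" and P :: "'b \<Rightarrow>\<^sub>L 'b"
  assumes deriv: "\<And>x. (\<Phi> has_derivative blinfun_apply (\<Phi>' x)) (at x)"
    and cont: "isCont \<Phi>' x0"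
    and idem: "\<And>y. P (P y) = P y"
    and C: "0 \<le> C"
    and right_inv: "\<And>y. P y = y \<Longrightarrow> \<exists>v. P (\<Phi>' x0 v) = y \<and> norm v \<le> C * norm y"
    and ker: "\<forall>\<^sub>F x in nhds x0. \<forall>v. P (\<Phi>' x v) = 0 \<longrightarrow> \<Phi>' x v = 0"
  obtains \<rho> where "0 < \<rho>"
    "\<And>x. x \<in> ball x0 \<rho> \<Longrightarrow> P (\<Phi> x) = P (\<Phi> x0) \<Longrightarrow> \<Phi> x = \<Phi> x0"
proof -
  define H where "H x = P (\<Phi> x)" for x
  define H' where "H' x = P o\<^sub>L \<Phi>' x" for x
  define W where "W = {y. P y = y}"
  have W: "subspace W"
    unfolding W_def by (rule subspaceI) (auto simp: blinfun.bilinear_simps)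
  have derivH: "(H has_derivative blinfun_apply (H' x)) (at x)" for x
    unfolding H_def H'_def blinfun_compose.rep_eq o_def
    by (rule bounded_linear.has_derivative[OF blinfun.bounded_linear_right deriv])
  have contH': "isCont H' x0"
    unfolding H'_def
    by (intro bounded_bilinear.continuous[OF bounded_bilinear_blinfun_compose] cont continuous_const)
  have H'W: "H' x v \<in> W" for x v
    by (simp add: H'_def W_def idem)
  define D where "D = 2 * C + 1"
  have D: "0 < D" "2 * C \<le> D"
    using C by (auto simp: D_def)
  define \<eta> where "\<eta> = 1 / (8 * D)"
  have \<eta>: "0 < \<eta>" "D * \<eta> = 1 / 8" "C * \<eta> \<le> 1 / 2"
    using C by (auto simp: \<eta>_def D_def field_simps)
  obtain \<rho>1 where \<rho>1: "0 < \<rho>1"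
    "\<And>x. x \<in> ball x0 \<rho>1 \<Longrightarrow> norm (H' x - H' x0) \<le> \<eta>"
    "\<And>x y. x \<in> ball x0 \<rho>1 \<Longrightarrow> y \<in> ball x0 \<rho>1 \<Longrightarrow>
      norm (H y - H x - H' x0 (y - x)) \<le> \<eta> * norm (y - x)"
    using C1_strict_differentiability[OF derivH contH' \<eta>(1)] by metis
  obtain \<rho>2 where \<rho>2: "0 < \<rho>2"
    "\<And>x v. dist x x0 < \<rho>2 \<Longrightarrow> P (\<Phi>' x v) = 0 \<Longrightarrow> \<Phi>' x v = 0"
    using ker unfolding eventually_nhds_metric by blast
  define \<rho> where "\<rho> = min \<rho>1 \<rho>2"
  have \<rho>: "0 < \<rho>" "\<rho> \<le> \<rho>1" "\<rho> \<le> \<rho>2"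
    using \<rho>1(1) \<rho>2(1) by (auto simp: \<rho>_def)
  \<comment> \<open>Derivatives at points near \<open>x0\<close> inherit the bounded right inverse, with one constant \<open>D\<close>.\<close>
  have openness: "\<exists>u. H' q u = w \<and> norm u \<le> D * norm w" if q: "q \<in> ball x0 \<rho>" and w: "w \<in> W" for q w
  proof -
    have "q \<in> ball x0 \<rho>1"
      using q \<rho>(2) by simp
    from \<rho>1(2)[OF this] C have "C * norm (H' q - H' x0) \<le> C * \<eta>"
      by (rule mult_left_mono)
    then have *: "C * norm (H' q - H' x0) \<le> 1 / 2"
      using \<eta>(3) by linarith
    have ri: "\<exists>v. H' x0 v = y \<and> norm v \<le> C * norm y" if "y \<in> W" for y
      using right_inv that by (simp add: W_def H'_def)
    obtain u where u: "H' q u = w" "norm u \<le> 2 * C * norm w"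
      using right_inverse_perturbation[OF W H'W ri C * w] by blast
    have "2 * C * norm w \<le> D * norm w"
      using D(2) by (rule mult_right_mono) simp
    with u show ?thesis
      by force
  qed
  have "\<Phi> x = \<Phi> x0" if x: "x \<in> ball x0 (\<rho> / 5)" and Hx: "P (\<Phi> x) = P (\<Phi> x0)" for x
  proof -
    define s where "s = norm (x - x0)"
    have s: "5 * s < \<rho>" "0 \<le> s"
      using x by (auto simp: s_def dist_norm norm_minus_commute)
    have walk: "\<exists>q. norm (\<Phi> q - \<Phi> x0) \<le> \<epsilon> * s \<and> norm (q - x) \<le> 4 * D * norm P * (\<epsilon> * s)"
      if "0 < \<epsilon>" for \<epsilon>
    proof -
      \<comment> \<open>Both the displacement and the change of \<open>\<Phi>\<close> are paid for by the decrease of the distance to \<open>x\<close>.\<close>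
      define R where "R p q \<longleftrightarrow> norm (q - p) \<le> 4 * (norm (x - p) - norm (x - q)) \<and>
        norm (\<Phi> q - \<Phi> p) \<le> \<epsilon> * (norm (x - p) - norm (x - q))" for p q
      have contPhi: "continuous_on UNIV \<Phi>"
        using deriv has_derivative_continuous by (blast intro: continuous_at_imp_continuous_on)
      have Rcl: "closed {q. R p q}" for p
        unfolding R_def
        by (intro closed_Collect_conj closed_Collect_le continuous_intros contPhi)
      have Rrefl: "R p p" for p
        by (simp add: R_def)
      have Rtr: "R p z" if "R p q" "R q z" for p q z
        using that norm_triangle_ineq[of "z - q" "q - p"]
          norm_triangle_ineq[of "\<Phi> z - \<Phi> q" "\<Phi> q - \<Phi> p"]
        unfolding R_def by (simp add: algebra_simps)
      have Rd: "dist p q \<le> 4 * norm (x - p) - 4 * norm (x - q)" if "R p q" for p q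
        using that by (simp add: R_def dist_norm norm_minus_commute algebra_simps)
      obtain q where q: "R x0 q" "\<And>z. R q z \<Longrightarrow> z = q"
        by (rule maximal_point_of_ordering[of R "\<lambda>p. 4 * norm (x - p)" x0,
              OF Rrefl Rtr Rcl Rd]) simp_all
      define n where "n = norm (x - q)"
      have n0: "0 \<le> n"
        by (simp add: n_def)
      have q0: "norm (q - x0) \<le> 4 * s" and \<Phi>q: "norm (\<Phi> q - \<Phi> x0) \<le> \<epsilon> * (s - n)"
        using q(1) unfolding R_def s_def n_def by (auto intro: order_trans)
      have qball: "q \<in> ball x0 \<rho>" and xball: "x \<in> ball x0 \<rho>"
        using q0 s x by (auto simp: dist_norm norm_minus_commute)
      have key: "n \<le> 4 * D * norm (H q - H x)"
      proof (rule ccontr)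
        assume far: "\<not> n \<le> 4 * D * norm (H q - H x)"
        moreover have "0 \<le> 4 * D * norm (H q - H x)"
          using D by simp
        ultimately have n: "0 < n"
          by linarith
        \<comment> \<open>\<open>u\<close> corrects the direction \<open>x - q\<close> to one in the kernel, at most half as long as \<open>x - q\<close>.\<close>
        obtain u where u: "H' q u = H' q (x - q)" "norm u \<le> D * norm (H' q (x - q))"
          using openness[OF qball H'W] by blast
        have "norm (H x - H q - H' x0 (x - q)) \<le> \<eta> * n"
          using \<rho>1(3)[of q x] qball xball \<rho>(2) by (simp add: n_def)
        moreover have "norm ((H' q - H' x0) (x - q)) \<le> \<eta> * n"
          using \<rho>1(2)[of q] qball \<rho>(2) norm_blinfun[of "H' q - H' x0" "x - q"]
            mult_right_mono[of "norm (H' q - H' x0)" \<eta> n] by (simp add: n_def)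
        moreover have "H' q (x - q) =
            (H' q - H' x0) (x - q) + (H x - H q) - (H x - H q - H' x0 (x - q))"
          by (simp add: blinfun.bilinear_simps)
        ultimately have "norm (H' q (x - q)) \<le> 2 * (\<eta> * n) + norm (H q - H x)"
          using norm_triangle_ineq4[of "(H' q - H' x0) (x - q) + (H x - H q)"
              "H x - H q - H' x0 (x - q)"]
            norm_triangle_ineq[of "(H' q - H' x0) (x - q)" "H x - H q"]
          by (simp add: norm_minus_commute)
        then have "D * norm (H' q (x - q)) \<le> D * (2 * (\<eta> * n) + norm (H q - H x))"
          using D(1) by (simp add: mult_left_mono)
        also have "\<dots> = 2 * (D * \<eta>) * n + D * norm (H q - H x)"
          by (simp add: algebra_simps)
        also have "\<dots> \<le> n / 2"
          using far by (simp add: \<eta>(2))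
        finally have un: "norm u \<le> n / 2"
          using u(2) by linarith
        define v where "v = x - q - u"
        have "P (\<Phi>' q v) = 0"
          using u(1) by (simp add: H'_def v_def blinfun.bilinear_simps)
        then have \<Phi>v: "\<Phi>' q v = 0"
          using \<rho>2(2)[of q v] qball \<rho>(3) by (simp add: dist_commute)
        have vn: "norm v \<le> 3 / 2 * n"
          using norm_triangle_ineq4[of "x - q" u] un by (simp add: v_def n_def)
        have "\<forall>e>0. \<exists>d>0. \<forall>y\<in>UNIV. norm (y - q) < d \<longrightarrow>
            norm (\<Phi> y - \<Phi> q - \<Phi>' q (y - q)) \<le> e * norm (y - q)"
          using deriv[of q] unfolding has_derivative_within_alt by blast
        then obtain \<delta> where \<delta>: "0 < \<delta>"
          "\<And>y. norm (y - q) < \<delta> \<Longrightarrow> norm (\<Phi> y - \<Phi> q - \<Phi>' q (y - q)) \<le> \<epsilon> / 3 * norm (y - q)"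
          using \<open>0 < \<epsilon>\<close> by (metis UNIV_I zero_less_divide_iff zero_less_numeral)
        \<comment> \<open>A step length for which the error of linearization at \<open>q\<close> is within the budget; the 1 in the
          denominator covers \<open>v = 0\<close>.\<close>
        define \<tau> where "\<tau> = min 1 (\<delta> / (norm v + 1))"
        have nv1: "0 < norm v + 1"
          using norm_ge_zero[of v] by linarith
        have \<tau>: "0 < \<tau>" "\<tau> \<le> 1"
          using \<delta>(1) nv1 by (auto simp: \<tau>_def)
        have "\<tau> * (norm v + 1) \<le> \<delta>"
          using nv1 mult_right_mono[of \<tau> "\<delta> / (norm v + 1)" "norm v + 1"] by (simp add: \<tau>_def)
        then have "\<tau> * norm v < \<delta>"
          using \<tau>(1) by (simp add: algebra_simps)
        then have "norm (\<Phi> (q + \<tau> *\<^sub>R v) - \<Phi> q) \<le> \<epsilon> / 3 * (\<tau> * norm v)"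
          using \<delta>(2)[of "q + \<tau> *\<^sub>R v"] \<tau>(1) \<Phi>v by (simp add: blinfun.bilinear_simps)
        also have "\<dots> \<le> \<epsilon> / 3 * (\<tau> * (3 / 2 * n))"
          using vn \<tau>(1) \<open>0 < \<epsilon>\<close> by (intro mult_left_mono) auto
        finally have \<Phi>step: "norm (\<Phi> (q + \<tau> *\<^sub>R v) - \<Phi> q) \<le> \<epsilon> * (\<tau> * n / 2)"
          by simp
        have "x - (q + \<tau> *\<^sub>R v) = (1 - \<tau>) *\<^sub>R (x - q) + \<tau> *\<^sub>R u"
          by (simp add: v_def algebra_simps)
        then have "norm (x - (q + \<tau> *\<^sub>R v)) \<le> (1 - \<tau>) * n + \<tau> * norm u"
          using norm_triangle_ineq[of "(1 - \<tau>) *\<^sub>R (x - q)" "\<tau> *\<^sub>R u"] \<tau> by (simp add: n_def)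
        also have "\<dots> \<le> (1 - \<tau>) * n + \<tau> * (n / 2)"
          using un \<tau>(1) by simp
        finally have gain: "\<tau> * n / 2 \<le> norm (x - q) - norm (x - (q + \<tau> *\<^sub>R v))"
          by (simp add: n_def algebra_simps)
        have "norm (\<tau> *\<^sub>R v) \<le> \<tau> * (3 / 2 * n)"
          using vn \<tau>(1) by simp
        also have "\<dots> \<le> 4 * (\<tau> * n / 2)"
          using \<tau>(1) n by simp
        finally have vstep: "norm (\<tau> *\<^sub>R v) \<le> 4 * (\<tau> * n / 2)" .
        have "R q (q + \<tau> *\<^sub>R v)"
          unfolding R_def add_diff_cancel_left'
          by (intro conjI order_trans[OF vstep mult_left_mono[OF gain]]
              order_trans[OF \<Phi>step mult_left_mono[OF gain]] less_imp_le[OF \<open>0 < \<epsilon>\<close>]) simp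
        from q(2)[OF this] have "\<tau> *\<^sub>R v = 0"
          by simp
        then show False
          using gain \<tau>(1) n by (simp add: mult_le_0_iff)
      qed
      \<comment> \<open>Since \<open>x\<close> lies on the fibre, the bound on the change of \<open>\<Phi>\<close> also bounds \<open>H q - H x\<close>.\<close>
      have ns: "\<epsilon> * (s - n) \<le> \<epsilon> * s"
        using \<open>0 < \<epsilon>\<close> n0 by simp
      have "norm (H q - H x) = norm (P (\<Phi> q - \<Phi> x0))"
        using Hx by (simp add: H_def blinfun.bilinear_simps)
      also have "\<dots> \<le> norm P * norm (\<Phi> q - \<Phi> x0)"
        by (rule norm_blinfun)
      also have "\<dots> \<le> norm P * (\<epsilon> * s)"
        using \<Phi>q ns by (intro mult_left_mono) auto
      finally have "4 * D * norm (H q - H x) \<le> 4 * D * (norm P * (\<epsilon> * s))"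
        using D(1) by (intro mult_left_mono) auto
      then show ?thesis
        using key \<Phi>q ns
        by (intro exI[of _ q]) (auto simp: n_def norm_minus_commute mult.assoc)
    qed
    have "\<forall>k::nat. \<exists>q. norm (\<Phi> q - \<Phi> x0) \<le> inverse (real (Suc k)) * s \<and>
        norm (q - x) \<le> 4 * D * norm P * (inverse (real (Suc k)) * s)"
      using walk by simp
    then obtain q where q: "\<And>k. norm (\<Phi> (q k) - \<Phi> x0) \<le> inverse (real (Suc k)) * s"
      "\<And>k. norm (q k - x) \<le> 4 * D * norm P * (inverse (real (Suc k)) * s)"
      by metis
    have "(\<lambda>k. inverse (real (Suc k)) * s) \<longlonglongrightarrow> 0 * s"
      by (intro tendsto_intros LIMSEQ_inverse_real_of_nat)
    then have z: "(\<lambda>k. inverse (real (Suc k)) * s) \<longlonglongrightarrow> 0"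
      by simp
    have "(\<lambda>k. \<Phi> (q k) - \<Phi> x0) \<longlonglongrightarrow> 0"
      by (rule Lim_null_comparison[OF _ z]) (use q in simp)
    then have lim1: "(\<lambda>k. \<Phi> (q k)) \<longlonglongrightarrow> \<Phi> x0"
      by (rule LIM_zero_cancel)
    have "(\<lambda>k. 4 * D * norm P * (inverse (real (Suc k)) * s)) \<longlonglongrightarrow> 4 * D * norm P * 0"
      by (intro tendsto_intros z)
    then have z': "(\<lambda>k. 4 * D * norm P * (inverse (real (Suc k)) * s)) \<longlonglongrightarrow> 0"
      by simp
    have "(\<lambda>k. q k - x) \<longlonglongrightarrow> 0"
      by (rule Lim_null_comparison[OF _ z']) (rule always_eventually, use q(2) in blast)
    then have "q \<longlonglongrightarrow> x"
      by (rule LIM_zero_cancel)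
    moreover have "isCont \<Phi> x"
      using deriv has_derivative_continuous by blast
    ultimately have "(\<lambda>k. \<Phi> (q k)) \<longlonglongrightarrow> \<Phi> x"
      using isCont_tendsto_compose by blast
    then show ?thesis
      using lim1 LIMSEQ_unique by blast
  qed
  then show thesis
    using that[of "\<rho> / 5"] \<rho>(1) by simp
qed

section \<open>Coefficients in a Besselian and Hilbertian basis\<close>

lemma L2_set_le_suminf:
  assumes "summable (\<lambda>i. (a i)\<^sup>2)" "finite I"
  shows "L2_set a I \<le> sqrt (\<Sum>i. (a i)\<^sup>2)"
  unfolding L2_set_def using assms by (intro real_sqrt_le_mono sum_le_suminf) auto

lemma L2_set_scale: "L2_set (\<lambda>i. c * f i) I = \<bar>c\<bar> * L2_set f I"
  by (simp add: L2_set_def power_mult_distrib real_sqrt_mult flip: sum_distrib_left)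

locale riesz_basis =
  fixes b :: "nat \<Rightarrow> 'b::{real_normed_vector,complete_space}" and bs :: "nat \<Rightarrow> 'b \<Rightarrow>\<^sub>L real"
  assumes biorth: "biorthogonal_functionals b bs"
    and bessel: "besselian UNIV b" and hilbert: "hilbertian UNIV b"
begin

lemma expansion: "(\<lambda>i. bs i y *\<^sub>R b i) sums y"
  using biorth by (simp add: biorthogonal_functionals_def)

lemma coord_basis: "bs i (b j) = (if i = j then 1 else 0)"
  using biorth by (simp add: biorthogonal_functionals_def)

lemma coord_eqI: "y = z" if "\<And>i. bs i y = bs i z"
  using expansion[of y] expansion[of z] that by (simp add: sums_unique2)

lemma coord_square_summable: "summable (\<lambda>i. (bs i y)\<^sup>2)"
  using bessel expansion[of y] unfolding besselian_def supported_on_def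
  by (auto dest: sums_summable)

lemma square_summable_is_coord:
  assumes "summable (\<lambda>i. (a i)\<^sup>2)"
  obtains y where "\<And>i. bs i y = a i"
proof -
  have "summable (\<lambda>i. a i *\<^sub>R b i)"
    using hilbert assms unfolding hilbertian_def supported_on_def by simp
  then have y: "(\<lambda>i. a i *\<^sub>R b i) sums (\<Sum>i. a i *\<^sub>R b i)" (is "_ sums ?y")
    by (rule summable_sums)
  have "bs i ?y = a i" for i
  proof -
    have "(\<lambda>j. bs i (a j *\<^sub>R b j)) sums bs i ?y"
      by (rule bounded_linear.sums[OF blinfun.bounded_linear_right y])
    moreover have "(\<lambda>j. bs i (a j *\<^sub>R b j)) = (\<lambda>j. if j = i then a j else 0)"
      by (auto simp: blinfun.bilinear_simps coord_basis)
    ultimately show ?thesis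
      using sums_single[of i a] sums_unique2 by metis
  qed
  then show thesis
    using that by blast
qed

text \<open>
  The coefficient sequences of a basis that is Besselian and Hilbertian are exactly the square summable
  sequences. The inner product that is natural for the coefficients is therefore that of \<open>\<ell>\<^sup>2\<close>,
  transported to the space: it makes the basis orthonormal, and its norm is equivalent to the given one.
\<close>

definition coord_norm :: "'b \<Rightarrow> real" where
  "coord_norm y = sqrt (\<Sum>i. (bs i y)\<^sup>2)"

definition coord_inner :: "'b \<Rightarrow> 'b \<Rightarrow> real" where
  "coord_inner y z = (\<Sum>i. bs i y * bs i z)"

lemma coord_norm_square: "(coord_norm y)\<^sup>2 = (\<Sum>i. (bs i y)\<^sup>2)"
  unfolding coord_norm_def by (simp add: suminf_nonneg coord_square_summable)

lemma coord_norm_nonneg: "0 \<le> coord_norm y"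
  unfolding coord_norm_def by (simp add: suminf_nonneg coord_square_summable)

lemma coord_norm_LIMSEQ: "(\<lambda>N. L2_set (\<lambda>i. bs i y) {..<N}) \<longlonglongrightarrow> coord_norm y"
  unfolding coord_norm_def L2_set_def
  by (intro tendsto_real_sqrt summable_LIMSEQ coord_square_summable)

lemma coord_norm_triangle: "coord_norm (y + z) \<le> coord_norm y + coord_norm z"
proof (rule LIMSEQ_le)
  show "(\<lambda>N. L2_set (\<lambda>i. bs i y) {..<N} + L2_set (\<lambda>i. bs i z) {..<N})
      \<longlonglongrightarrow> coord_norm y + coord_norm z"
    by (intro tendsto_add coord_norm_LIMSEQ)
  show "\<exists>N. \<forall>n\<ge>N. L2_set (\<lambda>i. bs i (y + z)) {..<n}
      \<le> L2_set (\<lambda>i. bs i y) {..<n} + L2_set (\<lambda>i. bs i z) {..<n}"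
    by (auto simp: blinfun.add_right intro: L2_set_triangle_ineq)
qed (rule coord_norm_LIMSEQ)

lemma coord_norm_eq_0D:
  assumes "coord_norm y = 0"
  shows "bs i y = 0"
proof -
  have "(\<Sum>i. (bs i y)\<^sup>2) = 0"
    using assms coord_norm_square[of y] by simp
  then show ?thesis
    using suminf_eq_zero_iff[OF coord_square_summable] by auto
qed

lemma L2_set_coord_le: "finite I \<Longrightarrow> L2_set (\<lambda>i. bs i y) I \<le> coord_norm y"
  unfolding coord_norm_def by (intro L2_set_le_suminf coord_square_summable)

lemma coord_inner_summable: "summable (\<lambda>i. bs i y * bs i z)"
proof (rule summable_comparison_test')
  show "summable (\<lambda>i. (bs i y)\<^sup>2 + (bs i z)\<^sup>2)"
    by (intro summable_add coord_square_summable)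
  show "norm (bs i y * bs i z) \<le> (bs i y)\<^sup>2 + (bs i z)\<^sup>2" if "i \<ge> 0" for i
  proof -
    have "0 \<le> \<bar>bs i y\<bar> * \<bar>bs i z\<bar>"
      by simp
    then show ?thesis
      using sum_squares_bound[of "\<bar>bs i y\<bar>" "\<bar>bs i z\<bar>"] unfolding power2_abs real_norm_def abs_mult
      by linarith
  qed
qed

lemma coord_norm_diff_scaleR_square:
  "(coord_norm (y - \<tau> *\<^sub>R z))\<^sup>2 = (coord_norm y)\<^sup>2 - 2 * \<tau> * coord_inner y z + \<tau>\<^sup>2 * (coord_norm z)\<^sup>2"
proof -
  have "(\<lambda>i. (bs i y)\<^sup>2 - 2 * \<tau> * (bs i y * bs i z) + \<tau>\<^sup>2 * (bs i z)\<^sup>2) sums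
      ((coord_norm y)\<^sup>2 - 2 * \<tau> * coord_inner y z + \<tau>\<^sup>2 * (coord_norm z)\<^sup>2)"
    unfolding coord_norm_square coord_inner_def
    by (intro sums_add sums_diff sums_mult summable_sums coord_square_summable coord_inner_summable)
  moreover have "(\<lambda>i. (bs i y)\<^sup>2 - 2 * \<tau> * (bs i y * bs i z) + \<tau>\<^sup>2 * (bs i z)\<^sup>2) =
      (\<lambda>i. (bs i (y - \<tau> *\<^sub>R z))\<^sup>2)"
    by (rule ext) (simp add: blinfun.bilinear_simps power2_eq_square algebra_simps)
  ultimately show ?thesis
    by (simp add: coord_norm_square sums_iff)
qed

lemma coord_norm_bounded:
  obtains M where "1 \<le> M" "\<And>y. coord_norm y \<le> M * norm y"
proof -
  have cont: "continuous_on UNIV (\<lambda>y. L2_set (\<lambda>i. bs i y) {..<N})" for N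
    unfolding L2_set_def by (intro continuous_intros)
  have triangle: "L2_set (\<lambda>i. bs i (x + y)) {..<N} \<le>
      L2_set (\<lambda>i. bs i x) {..<N} + L2_set (\<lambda>i. bs i y) {..<N}" for x y N
    unfolding blinfun.add_right by (rule L2_set_triangle_ineq)
  have scale: "L2_set (\<lambda>i. bs i (c *\<^sub>R x)) {..<N} = \<bar>c\<bar> * L2_set (\<lambda>i. bs i x) {..<N}" for c x N
    by (simp add: blinfun.scaleR_right L2_set_scale)
  have pointwise: "\<exists>B. \<forall>N. L2_set (\<lambda>i. bs i y) {..<N} \<le> B" for y
    using L2_set_coord_le by (intro exI[of _ "coord_norm y"]) simp
  obtain C where C: "0 < C" "\<And>N y. L2_set (\<lambda>i. bs i y) {..<N} \<le> C * norm y"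
    by (rule uniform_boundedness[of UNIV "\<lambda>N y. L2_set (\<lambda>i. bs i y) {..<N}",
          OF closed_UNIV subspace_UNIV cont triangle scale pointwise]) auto
  have "coord_norm y \<le> C * norm y" for y
    by (rule LIMSEQ_le_const2[OF coord_norm_LIMSEQ]) (use C in blast)
  moreover have "C * norm y \<le> (C + 1) * norm y" for y
    by (simp add: mult_right_mono)
  ultimately have "coord_norm y \<le> (C + 1) * norm y" for y
    by (rule order_trans)
  then show thesis
    using that[of "C + 1"] C(1) by simp
qed

text \<open>
  Deleting the coefficients outside \<open>J\<close> is possible because square summability is inherited by subfamilies;
  the operator is bounded as a pointwise limit of bounded partial sums.
\<close>

lemma coord_projection:
  fixes J :: "nat set"
  obtains P :: "'b \<Rightarrow>\<^sub>L 'b" where "\<And>i y. bs i (P y) = (if i \<in> J then bs i y else 0)"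
proof -
  define c where "c y i = (if i \<in> J then bs i y else 0)" for y i
  have "\<exists>z. \<forall>i. bs i z = c y i" for y
  proof -
    have "summable (\<lambda>i. (c y i)\<^sup>2)"
      by (rule summable_comparison_test'[OF coord_square_summable[of y]]) (simp add: c_def)
    then show ?thesis
      using square_summable_is_coord by blast
  qed
  then obtain P where P: "\<And>y i. bs i (P y) = c y i"
    by metis
  define p where "p N y = norm (\<Sum>i<N. c y i *\<^sub>R b i)" for N y
  have lim: "(\<lambda>N. p N y) \<longlonglongrightarrow> norm (P y)" for y
    using tendsto_norm[OF expansion[of "P y", unfolded sums_def]] by (simp add: P p_def)
  have cadd: "c (y + z) i = c y i + c z i" and cscale: "c (k *\<^sub>R y) i = k * c y i" for y z k i
    by (simp_all add: c_def blinfun.bilinear_simps)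
  have cont: "continuous_on UNIV (p N)" for N
  proof -
    have "continuous_on UNIV (\<lambda>y. c y i)" for i
      by (cases "i \<in> J") (simp_all add: c_def, intro continuous_intros)
    then show ?thesis
      unfolding p_def by (intro continuous_intros)
  qed
  have triangle: "p N (y + z) \<le> p N y + p N z" for N y z
    unfolding p_def cadd scaleR_left_distrib sum.distrib by (rule norm_triangle_ineq)
  have scale: "p N (k *\<^sub>R y) = \<bar>k\<bar> * p N y" for N k y
    unfolding p_def cscale by (simp flip: scaleR_scaleR scaleR_sum_right)
  have pointwise: "\<exists>B. \<forall>N. p N y \<le> B" for y
  proof -
    have "Bseq (\<lambda>N. p N y)"
      using lim convergent_def convergent_imp_Bseq by blast
    then show ?thesis
      unfolding Bseq_def by (auto intro: order_trans[OF abs_ge_self])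
  qed
  obtain C where C: "0 < C" "\<And>N y. p N y \<le> C * norm y"
    by (rule uniform_boundedness[of UNIV p, OF closed_UNIV subspace_UNIV cont triangle scale pointwise])
      auto
  have "bounded_linear P"
  proof (rule bounded_linear_intro)
    show "P (y + z) = P y + P z" for y z
      by (rule coord_eqI) (simp add: P cadd blinfun.add_right)
    show "P (k *\<^sub>R y) = k *\<^sub>R P y" for k y
      by (rule coord_eqI) (simp add: P cscale blinfun.scaleR_right)
    show "norm (P y) \<le> norm y * C" for y
      by (rule LIMSEQ_le_const2[OF lim]) (use C in \<open>auto simp: mult.commute\<close>)
  qed
  then show thesis
    using that[of "Blinfun P"] by (simp add: bounded_linear_Blinfun_apply P c_def)
qed

end

section \<open>Surjectivity from a Besselian basis of rows\<close>

lemma basis_coeff_eqI: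
  assumes basis: "schauder_basis J v X" and x: "x \<in> X"
    and a: "supported_on J a" "(\<lambda>i. a i *\<^sub>R v i) sums x"
  shows "basis_coeff J v i x = a i"
proof -
  have "\<exists>!a. supported_on J a \<and> (\<lambda>i. a i *\<^sub>R v i) sums x"
    using basis x unfolding schauder_basis_def by blast
  then have "(THE a. supported_on J a \<and> (\<lambda>i. a i *\<^sub>R v i) sums x) = a"
    by (rule the1_equality) (use a in blast)
  then show ?thesis
    by (simp add: basis_coeff_def)
qed

context riesz_basis
begin

text \<open>
  The functional \<open>\<phi> = (\<Sum>i. bs i y *\<^sub>R (bs i o\<^sub>L A))\<close> is the value at \<open>y\<close> of the adjoint of \<open>A\<close> for the coefficient inner
  product, and the point is that \<open>norm \<phi>\<close> dominates the coefficient norm of \<open>y\<close>: the Besselian property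
  makes the coefficients of every element of \<open>X\<close> square summable, these coefficients are continuous, being
  evaluations at points \<open>e i\<close>, and so uniform boundedness applies. An almost norming vector of
  \<open>\<phi>\<close> is then the required \<open>e\<close>. In other words, the adjoint is bounded below, which is the dual form
  of surjectivity.
\<close>

lemma besselian_rows_lower_bound:
  fixes A :: "'a::real_normed_vector \<Rightarrow>\<^sub>L 'b"
  assumes basis: "schauder_basis J (\<lambda>i. bs i o\<^sub>L A) X"
    and besselian_rows: "besselian J (\<lambda>i. bs i o\<^sub>L A)"
    and evaluation: "\<And>i. i \<in> J \<Longrightarrow> \<exists>e. \<forall>\<phi>\<in>X. basis_coeff J (\<lambda>i. bs i o\<^sub>L A) i \<phi> = blinfun_apply \<phi> e"
  obtains K where "1 \<le> K"
    "\<And>y. (\<And>i. i \<notin> J \<Longrightarrow> bs i y = 0) \<Longrightarrow>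
      \<exists>e. norm e \<le> 1 \<and> coord_norm y \<le> K * coord_inner y (A e)"
proof -
  define row where "row i = bs i o\<^sub>L A" for i
  have X: "closed X" "subspace X" "\<And>i. i \<in> J \<Longrightarrow> row i \<in> X"
    using basis by (auto simp: schauder_basis_def row_def)
  obtain e where e: "\<And>i \<phi>. i \<in> J \<Longrightarrow> \<phi> \<in> X \<Longrightarrow> basis_coeff J row i \<phi> = blinfun_apply \<phi> (e i)"
    using evaluation unfolding row_def by metis
  have coeff: "blinfun_apply \<phi> (e i) = a i"
    if "\<phi> \<in> X" "supported_on J a" "(\<lambda>i. a i *\<^sub>R row i) sums \<phi>" "i \<in> J" for \<phi> a i
    using basis_coeff_eqI[OF basis[folded row_def] that(1-3), of i] e[OF that(4,1)] by simp
  define c where "c \<phi> i = (if i \<in> J then blinfun_apply \<phi> (e i) else 0)" for \<phi> :: "'a \<Rightarrow>\<^sub>L real" and i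
  have cadd: "c (\<phi> + \<psi>) i = c \<phi> i + c \<psi> i" and cscale: "c (k *\<^sub>R \<phi>) i = k * c \<phi> i" for \<phi> \<psi> k i
    by (simp_all add: c_def blinfun.bilinear_simps)
  have coeff': "c \<phi> i = a i"
    if "\<phi> \<in> X" "supported_on J a" "(\<lambda>i. a i *\<^sub>R row i) sums \<phi>" for \<phi> a i
    using coeff[OF that] that(2) by (auto simp: c_def supported_on_def)
  have cont: "continuous_on UNIV (\<lambda>\<phi>. L2_set (c \<phi>) {..<N})" for N
  proof -
    have "continuous_on UNIV (\<lambda>\<phi>. c \<phi> i)" for i
      by (cases "i \<in> J") (simp_all add: c_def, intro continuous_intros)
    then show ?thesis
      unfolding L2_set_def by (intro continuous_intros)
  qed
  have triangle: "L2_set (c (\<phi> + \<psi>)) {..<N} \<le> L2_set (c \<phi>) {..<N} + L2_set (c \<psi>) {..<N}" for \<phi> \<psi> N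
    unfolding cadd by (rule L2_set_triangle_ineq)
  have scale: "L2_set (c (k *\<^sub>R \<phi>)) {..<N} = \<bar>k\<bar> * L2_set (c \<phi>) {..<N}" for k \<phi> N
    unfolding cscale by (rule L2_set_scale)
  have pointwise: "\<exists>B. \<forall>N. L2_set (c \<phi>) {..<N} \<le> B" if \<phi>: "\<phi> \<in> X" for \<phi>
  proof -
    obtain a where a: "supported_on J a" "(\<lambda>i. a i *\<^sub>R row i) sums \<phi>"
      using basis \<phi> unfolding schauder_basis_def row_def by blast
    then have "summable (\<lambda>i. (a i)\<^sup>2)"
      using besselian_rows unfolding besselian_def row_def by (auto dest: sums_summable)
    moreover have "c \<phi> = a"
      using coeff'[OF \<phi> a] by blast
    ultimately show ?thesis
      using L2_set_le_suminf[of a] by blast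
  qed
  obtain C where C: "0 < C" "\<And>N \<phi>. \<phi> \<in> X \<Longrightarrow> L2_set (c \<phi>) {..<N} \<le> C * norm \<phi>"
    by (rule uniform_boundedness[of X "\<lambda>N \<phi>. L2_set (c \<phi>) {..<N}",
          OF X(1,2) cont triangle scale pointwise]) auto
  obtain M where M: "1 \<le> M" "\<And>y. coord_norm y \<le> M * norm y"
    using coord_norm_bounded by blast
  have "\<exists>e. norm e \<le> 1 \<and> coord_norm y \<le> (2 * C + 1) * coord_inner y (A e)"
    if y: "\<And>i. i \<notin> J \<Longrightarrow> bs i y = 0" for y
  proof -
    define f where "f i = bs i y *\<^sub>R row i" for i
    \<comment> \<open>The tails of the series are small as functionals, by the Cauchy-Schwarz inequality.\<close>
    have tail: "norm (sum f I) \<le> L2_set (\<lambda>i. bs i y) I * (M * norm A)" if "finite I" for I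
    proof (rule norm_blinfun_bound)
      show "0 \<le> L2_set (\<lambda>i. bs i y) I * (M * norm A)"
        using M(1) by (simp add: L2_set_nonneg)
      fix v
      have "norm (blinfun_apply (sum f I) v) = \<bar>\<Sum>i\<in>I. bs i y * bs i (A v)\<bar>"
        by (simp add: f_def row_def blinfun.bilinear_simps blinfun.sum_left)
      also have "\<dots> \<le> (\<Sum>i\<in>I. \<bar>bs i y\<bar> * \<bar>bs i (A v)\<bar>)"
        unfolding abs_mult[symmetric] by (rule sum_abs)
      also have "\<dots> \<le> L2_set (\<lambda>i. bs i y) I * L2_set (\<lambda>i. bs i (A v)) I"
        by (rule L2_set_mult_ineq)
      also have "\<dots> \<le> L2_set (\<lambda>i. bs i y) I * (M * (norm A * norm v))"
      proof (rule mult_left_mono)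
        have "L2_set (\<lambda>i. bs i (A v)) I \<le> M * norm (A v)"
          using L2_set_coord_le[OF that] M(2) order_trans by blast
        also have "\<dots> \<le> M * (norm A * norm v)"
          using M(1) norm_blinfun[of A v] by (intro mult_left_mono) auto
        finally show "L2_set (\<lambda>i. bs i (A v)) I \<le> M * (norm A * norm v)" .
      qed (rule L2_set_nonneg)
      finally show "norm (blinfun_apply (sum f I) v) \<le> L2_set (\<lambda>i. bs i y) I * (M * norm A) * norm v"
        by (simp add: mult_ac)
    qed
    have "summable f"
    proof (rule summable_Cauchy[THEN iffD2], intro allI impI)
      fix \<epsilon> :: real assume "0 < \<epsilon>"
      define B where "B = M * norm A + 1"
      have B: "0 < B"
        using M(1) by (simp add: B_def add_nonneg_pos)
      have "0 < (\<epsilon> / B)\<^sup>2"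
        using \<open>0 < \<epsilon>\<close> B by simp
      then obtain N where N: "\<And>m n. m \<ge> N \<Longrightarrow> norm (\<Sum>i=m..<n. (bs i y)\<^sup>2) < (\<epsilon> / B)\<^sup>2"
        using coord_square_summable[of y] unfolding summable_Cauchy by metis
      have "norm (sum f {m..<n}) < \<epsilon>" if "m \<ge> N" for m n
      proof -
        have "(\<Sum>i=m..<n. (bs i y)\<^sup>2) < (\<epsilon> / B)\<^sup>2"
          using N[OF that, of n] by (simp add: sum_nonneg)
        then have "L2_set (\<lambda>i. bs i y) {m..<n} < \<epsilon> / B"
          using real_sqrt_less_mono[of _ "(\<epsilon> / B)\<^sup>2"] \<open>0 < \<epsilon>\<close> B by (force simp: L2_set_def)
        then have "L2_set (\<lambda>i. bs i y) {m..<n} * B < \<epsilon>"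
          using B by (simp add: field_simps)
        moreover have "L2_set (\<lambda>i. bs i y) {m..<n} * (M * norm A) \<le> L2_set (\<lambda>i. bs i y) {m..<n} * B"
          by (intro mult_left_mono) (auto simp: B_def L2_set_nonneg)
        ultimately show ?thesis
          using tail[of "{m..<n}"] by simp
      qed
      then show "\<exists>N. \<forall>m\<ge>N. \<forall>n. norm (sum f {m..<n}) < \<epsilon>"
        by blast
    qed
    then obtain \<phi> where \<phi>: "f sums \<phi>"
      by (auto simp: summable_def)
    have "f i \<in> X" for i
      using X(2) y X(3)[THEN subspace_scale[OF X(2)], of i] subspace_0[of X]
      by (cases "i \<in> J") (auto simp: f_def)
    then have "sum f {..<N} \<in> X" for N
      using X(2) by (intro subspace_sum)
    then have \<phi>X: "\<phi> \<in> X"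
      using closed_sequentially[OF X(1), of "\<lambda>N. sum f {..<N}" \<phi>] \<phi> by (auto simp: sums_def)
    have "c \<phi> = (\<lambda>i. bs i y)"
      using coeff'[OF \<phi>X, of "\<lambda>i. bs i y"] y \<phi> by (auto simp: supported_on_def f_def[abs_def])
    then have "L2_set (\<lambda>i. bs i y) {..<N} \<le> C * norm \<phi>" for N
      using C(2)[OF \<phi>X, of N] by simp
    then have "coord_norm y \<le> C * norm \<phi>"
      by (intro LIMSEQ_le_const2[OF coord_norm_LIMSEQ]) blast
    have pair: "blinfun_apply \<phi> v = coord_inner y (A v)" for v
    proof -
      have "(\<lambda>i. blinfun_apply (f i) v) sums blinfun_apply \<phi> v"
        by (rule bounded_linear.sums[OF blinfun.bounded_linear_left \<phi>])
      then show ?thesis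
        unfolding coord_inner_def by (simp add: f_def row_def blinfun.bilinear_simps sums_iff)
    qed
    obtain u where u: "norm u \<le> 1" "norm \<phi> \<le> 2 * blinfun_apply \<phi> u"
    proof (cases "norm \<phi> = 0")
      case True
      then show thesis
        using that[of 0] by simp
    next
      case False
      then have "\<not> norm \<phi> \<le> norm \<phi> / 2"
        by simp
      then obtain v where v: "norm \<phi> / 2 * norm v < norm (blinfun_apply \<phi> v)"
        using norm_blinfun_bound[of "norm \<phi> / 2" \<phi>] by (meson half_gt_zero_iff norm_ge_zero not_le
            divide_nonneg_pos zero_less_numeral)
      then have v0: "0 < norm v"
        by (auto simp: blinfun.zero_right)
      define u where "u = (sgn (blinfun_apply \<phi> v) / norm v) *\<^sub>R v"
      have "norm u \<le> 1"
        using v0 by (simp add: u_def abs_sgn_eq)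
      moreover have "blinfun_apply \<phi> u = \<bar>blinfun_apply \<phi> v\<bar> / norm v"
        by (simp add: u_def blinfun.bilinear_simps abs_sgn mult.commute)
      then have "norm \<phi> / 2 < blinfun_apply \<phi> u"
        using v v0 by (simp only: pos_less_divide_eq real_norm_def)
      ultimately show thesis
        using that[of u] by simp
    qed
    have "coord_norm y \<le> C * (2 * blinfun_apply \<phi> u)"
      using \<open>coord_norm y \<le> C * norm \<phi>\<close> mult_left_mono[OF u(2), of C] C(1) by linarith
    moreover have "0 \<le> blinfun_apply \<phi> u"
      using u(2) norm_ge_zero[of \<phi>] by linarith
    ultimately have "coord_norm y \<le> (2 * C + 1) * blinfun_apply \<phi> u"
      by (simp add: algebra_simps)
    then show ?thesis
      using u(1) pair by metis
  qed
  then show thesis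
    using that[of "2 * C + 1"] C(1) by simp
qed

text \<open>
  Steepest descent turns the lower bound into solvability. For the residual \<open>y\<close> of the equation there
  is a unit vector \<open>e\<close> such that \<open>A e\<close> has a component along \<open>y\<close> of a fixed proportion \<open>1 / K\<close>, so a step of
  length \<open>coord_norm y / (K * B^2)\<close> along \<open>e\<close> reduces the residual by the fixed factor \<open>\<theta>\<close>. A geometric series of
  such steps gives an exact solution of controlled norm. Only the coefficients in \<open>J\<close> are prescribed.
\<close>

lemma besselian_rows_right_inverse:
  fixes A :: "'a::{real_normed_vector,complete_space} \<Rightarrow>\<^sub>L 'b"
  assumes basis: "schauder_basis J (\<lambda>i. bs i o\<^sub>L A) X"
    and besselian_rows: "besselian J (\<lambda>i. bs i o\<^sub>L A)"
    and evaluation: "\<And>i. i \<in> J \<Longrightarrow> \<exists>e. \<forall>\<phi>\<in>X. basis_coeff J (\<lambda>i. bs i o\<^sub>L A) i \<phi> = blinfun_apply \<phi> e"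
  obtains C where "0 \<le> C"
    "\<And>w. \<exists>v. (\<forall>i\<in>J. bs i (A v) = bs i w) \<and> norm v \<le> C * norm w"
proof -
  obtain K where K: "1 \<le> K"
    "\<And>y. (\<And>i. i \<notin> J \<Longrightarrow> bs i y = 0) \<Longrightarrow>
      \<exists>e. norm e \<le> 1 \<and> coord_norm y \<le> K * coord_inner y (A e)"
    using besselian_rows_lower_bound[OF assms] by blast
  obtain M where M: "1 \<le> M" "\<And>y. coord_norm y \<le> M * norm y"
    using coord_norm_bounded by blast
  obtain P :: "'b \<Rightarrow>\<^sub>L 'b" where P: "\<And>i y. bs i (P y) = (if i \<in> J then bs i y else 0)"
    using coord_projection by blast
  define B where "B = M * norm (P o\<^sub>L A) + 1"
  have B: "1 \<le> B"
    using M(1) by (simp add: B_def)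
  have PA: "coord_norm (P (A e)) \<le> B" if "norm e \<le> 1" for e
  proof -
    have "norm (P (A e)) \<le> norm (P o\<^sub>L A)"
      using norm_blinfun[of "P o\<^sub>L A" e] that mult_left_le[of "norm e" "norm (P o\<^sub>L A)"] by simp
    then have "M * norm (P (A e)) \<le> M * norm (P o\<^sub>L A)"
      using M(1) by (intro mult_left_mono) auto
    then show ?thesis
      using M(2)[of "P (A e)"] by (simp add: B_def)
  qed
  define \<theta> where "\<theta> = sqrt (1 - 1 / (K * B)\<^sup>2)"
  have KB: "1 \<le> K * B"
    using mult_mono[OF K(1) B] K(1) by simp
  have \<theta>: "\<theta> < 1" "0 \<le> \<theta>" "\<theta>\<^sup>2 = 1 - 1 / (K * B)\<^sup>2"
    using KB one_le_power[OF KB, of 2] by (auto simp: \<theta>_def divide_le_eq_1)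
  have "\<exists>v. (\<forall>i\<in>J. bs i (A v) = bs i w) \<and> norm v \<le> 1 / (1 - \<theta>) * (M * norm P) * norm w" for w
  proof -
    define h where "h v = coord_norm (P (w - A v))" for v
    have hnn: "0 \<le> h v" for v
      by (simp add: h_def coord_norm_nonneg)
    have diff: "h v - h u \<le> M * norm (P o\<^sub>L A) * norm (v - u)" for u v
    proof -
      have "P (w - A v) = P (w - A u) + P (A (u - v))"
        by (simp add: blinfun.bilinear_simps)
      then have "h v - h u \<le> coord_norm (P (A (u - v)))"
        using coord_norm_triangle[of "P (w - A u)" "P (A (u - v))"] by (simp add: h_def)
      also have "\<dots> \<le> M * norm ((P o\<^sub>L A) (u - v))"
        using M(2) by simp
      also have "\<dots> \<le> M * (norm (P o\<^sub>L A) * norm (v - u))"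
        using M(1) norm_blinfun[of "P o\<^sub>L A" "u - v"]
        by (intro mult_left_mono) (auto simp: norm_minus_commute)
      finally show ?thesis
        by (simp add: mult.assoc)
    qed
    have "(M * norm (P o\<^sub>L A))-lipschitz_on UNIV h"
    proof (rule lipschitz_onI)
      show "dist (h u) (h v) \<le> M * norm (P o\<^sub>L A) * dist u v" for u v
        using diff[of u v] diff[of v u] by (simp add: dist_norm norm_minus_commute abs_le_iff)
      show "0 \<le> M * norm (P o\<^sub>L A)"
        using M(1) by simp
    qed
    then have hcont: "continuous_on UNIV h"
      by (rule lipschitz_on_continuous_on)
    have step: "\<exists>q'. dist q q' \<le> 1 * h q \<and> h q' \<le> \<theta> * h q" for q
    proof -
      define y where "y = P (w - A q)"
      have hq: "h q = coord_norm y"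
        by (simp add: h_def y_def)
      obtain e where e: "norm e \<le> 1" "h q \<le> K * coord_inner y (A e)"
        using K(2)[of y] P by (auto simp: y_def h_def)
      define z where "z = P (A e)"
      have yz: "coord_inner y (A e) = coord_inner y z"
      proof -
        have "(\<lambda>i. bs i y * bs i (A e)) = (\<lambda>i. bs i y * bs i z)"
          by (rule ext) (simp add: y_def z_def P)
        then show ?thesis
          unfolding coord_inner_def by (rule arg_cong)
      qed
      \<comment> \<open>The minimizer of \<open>(h q)^2 - 2 * \<tau> * h q / K + \<tau>^2 * B^2\<close>.\<close>
      define \<tau> where "\<tau> = h q / (K * B\<^sup>2)"
      have \<tau>0: "0 \<le> \<tau>"
        using hnn[of q] K(1) by (simp add: \<tau>_def)
      have "h (q + \<tau> *\<^sub>R e) = coord_norm (y - \<tau> *\<^sub>R z)"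
        by (simp add: h_def y_def z_def blinfun.bilinear_simps algebra_simps)
      then have "(h (q + \<tau> *\<^sub>R e))\<^sup>2 = (h q)\<^sup>2 - 2 * \<tau> * coord_inner y z + \<tau>\<^sup>2 * (coord_norm z)\<^sup>2"
        by (simp add: coord_norm_diff_scaleR_square hq)
      also have "\<dots> \<le> (h q)\<^sup>2 - 2 * \<tau> * (h q / K) + \<tau>\<^sup>2 * B\<^sup>2"
      proof -
        have "h q / K \<le> coord_inner y z"
          using e(2) K(1) yz by (simp add: field_simps)
        then have "2 * \<tau> * (h q / K) \<le> 2 * \<tau> * coord_inner y z"
          using \<tau>0 by (intro mult_left_mono) auto
        moreover have "\<tau>\<^sup>2 * (coord_norm z)\<^sup>2 \<le> \<tau>\<^sup>2 * B\<^sup>2"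
          using PA[OF e(1)] coord_norm_nonneg by (intro mult_left_mono power_mono) (auto simp: z_def)
        ultimately show ?thesis
          by linarith
      qed
      also have "\<dots> = (1 - 1 / (K * B)\<^sup>2) * (h q)\<^sup>2"
        using K(1) B by (simp add: \<tau>_def power2_eq_square field_simps)
      also have "\<dots> = (\<theta> * h q)\<^sup>2"
        by (simp only: power_mult_distrib \<theta>(3))
      finally have "h (q + \<tau> *\<^sub>R e) \<le> \<theta> * h q"
        by (rule power2_le_imp_le) (simp add: \<theta>(2) hnn)
      moreover have "dist q (q + \<tau> *\<^sub>R e) \<le> h q"
      proof -
        have "1 \<le> K * B\<^sup>2"
          using mult_mono[OF K(1) one_le_power[OF B, of 2]] K(1) by simp
        then have "\<tau> \<le> h q"
          using hnn[of q] by (simp add: \<tau>_def divide_le_eq mult_left_le_one_le) (simp add: mult_le_cancel_left1)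
        moreover have "\<tau> * norm e \<le> \<tau> * 1"
          using e(1) \<tau>0 by (rule mult_left_mono)
        ultimately show ?thesis
          using \<tau>0 by (simp add: dist_norm)
      qed
      ultimately show ?thesis
        by (intro exI[of _ "q + \<tau> *\<^sub>R e"]) simp
    qed
    obtain v where v: "h v = 0" "dist 0 v \<le> 1 / (1 - \<theta>) * h 0"
      by (rule root_by_descent[of h \<theta> 1 0, OF hcont hnn \<theta>(1) zero_le_one step])
    have "bs i (A v) = bs i w" if "i \<in> J" for i
      using coord_norm_eq_0D[of "P (w - A v)" i] v(1) that by (simp add: h_def P blinfun.bilinear_simps)
    moreover have "h 0 \<le> M * norm P * norm w"
    proof -
      have "h 0 \<le> M * norm (P w)"
        using M(2) by (simp add: h_def)
      also have "\<dots> \<le> M * (norm P * norm w)"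
        using M(1) norm_blinfun[of P w] by (intro mult_left_mono) auto
      finally show ?thesis
        by (simp add: mult.assoc)
    qed
    then have "1 / (1 - \<theta>) * h 0 \<le> 1 / (1 - \<theta>) * (M * norm P * norm w)"
      using \<theta>(1) by (intro mult_left_mono) auto
    ultimately show ?thesis
      using v(2) by (intro exI[of _ v]) (auto simp: mult.assoc)
  qed
  moreover have "0 \<le> 1 / (1 - \<theta>) * (M * norm P)"
    using \<theta>(1) M(1) by simp
  ultimately show thesis
    using that by blast
qed

end

section \<open>Derivatives\<close>

lemma fderiv_eqI:
  assumes "(f has_derivative blinfun_apply D) (at x)"
  shows "fderiv f x = D"
  unfolding fderiv_def frechet_derivative_at[OF assms, symmetric] by (rule blinfun_apply_inverse)

lemma class_C1_has_derivative:
  assumes "class_C1 G"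
  shows "(G has_derivative blinfun_apply (fderiv G x)) (at x)"
proof -
  have D: "(G has_derivative frechet_derivative G (at x)) (at x)"
    using assms frechet_derivative_works by (auto simp: class_C1_def)
  then have "blinfun_apply (fderiv G x) = frechet_derivative G (at x)"
    unfolding fderiv_def by (intro bounded_linear_Blinfun_apply has_derivative_bounded_linear)
  with D show ?thesis
    by simp
qed

lemma class_C1_continuous_fderiv: "isCont (fderiv G) x" if "class_C1 G"
  using that by (simp add: class_C1_def continuous_on_eq_continuous_at)

lemma fderiv_coordinate:
  assumes "class_C1 G"
  shows "fderiv (blinfun_apply l \<circ> G) x = l o\<^sub>L fderiv G x"
  unfolding o_def
  by (rule fderiv_eqI, unfold blinfun_compose.rep_eq o_def)
    (rule bounded_linear.has_derivative[OF blinfun.bounded_linear_right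
        class_C1_has_derivative[OF assms]])

text \<open>
  A Frechet derivative is also the limit of difference quotients along moving directions; this is what
  relates tangent cones of a set and of its image, and the case of a fixed direction is used as well.
\<close>

lemma hadamard_derivative:
  fixes f :: "'a::real_normed_vector \<Rightarrow> 'b::real_normed_vector" and X :: "'c \<Rightarrow> 'a"
  assumes D: "(f has_derivative D) (at x)"
    and X: "(X \<longlongrightarrow> x) F" and t: "\<forall>\<^sub>F k in F. 0 < (t k :: real)"
    and d: "((\<lambda>k. (X k - x) /\<^sub>R t k) \<longlongrightarrow> d) F"
  shows "((\<lambda>k. (f (X k) - f x) /\<^sub>R t k) \<longlongrightarrow> D d) F"
proof -
  define E where "E y = (f y - f x - D (y - x)) /\<^sub>R norm (y - x)" for y
  have lin: "bounded_linear D"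
    using D by (rule has_derivative_bounded_linear)
  have "(E \<longlongrightarrow> 0) (at x)"
    using D unfolding has_derivative_at_within E_def
    by (simp add: inverse_eq_divide diff_diff_eq)
  then have "isCont E x"
    by (simp add: isCont_def E_def)
  then have E0: "((\<lambda>k. E (X k)) \<longlongrightarrow> 0) F"
    using isCont_tendsto_compose[OF _ X, of E] by (simp add: E_def)
  have "((\<lambda>k. D ((X k - x) /\<^sub>R t k) + norm ((X k - x) /\<^sub>R t k) *\<^sub>R E (X k))
      \<longlongrightarrow> D d + norm d *\<^sub>R 0) F"
    by (intro tendsto_intros d E0 bounded_linear.tendsto[OF lin])
  moreover have "\<forall>\<^sub>F k in F. D ((X k - x) /\<^sub>R t k) + norm ((X k - x) /\<^sub>R t k) *\<^sub>R E (X k) =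
      (f (X k) - f x) /\<^sub>R t k"
    using t
  proof eventually_elim
    case (elim k)
    have "norm (X k - x) *\<^sub>R E (X k) = f (X k) - f x - D (X k - x)"
      by (cases "X k = x") (simp_all add: E_def linear_0[OF bounded_linear.linear[OF lin]])
    then have "norm ((X k - x) /\<^sub>R t k) *\<^sub>R E (X k) = (f (X k) - f x - D (X k - x)) /\<^sub>R t k"
      using elim by (simp flip: scaleR_scaleR)
    moreover have "D ((X k - x) /\<^sub>R t k) = D (X k - x) /\<^sub>R t k"
      by (rule linear_scale[OF bounded_linear.linear[OF lin]])
    ultimately show ?case
      by (simp only: flip: scaleR_add_right) simp
  qed
  ultimately have "((\<lambda>k. (f (X k) - f x) /\<^sub>R t k) \<longlongrightarrow> D d + norm d *\<^sub>R 0) F"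
    by (rule Lim_transform_eventually)
  then show ?thesis
    by simp
qed

section \<open>Curves under the constant rank condition\<close>

context riesz_basis
begin

text \<open>
  A basis of the closed span of all the rows has the same common kernel as all the rows. Applied to
  derivatives at every point near \<open>x0\<close>, this is the constant rank hypothesis in the form in which it is used.
\<close>

lemma row_vanishes_on_common_kernel:
  assumes basis: "schauder_basis J2 (\<lambda>i. bs i o\<^sub>L A) (closure (span ((\<lambda>i. bs i o\<^sub>L A) ` J)))"
    and zero: "\<And>i. i \<in> J2 \<Longrightarrow> bs i (blinfun_apply A v) = 0" and i: "i \<in> J"
  shows "bs i (A v) = 0"
proof -
  have "bs i o\<^sub>L A \<in> closure (span ((\<lambda>i. bs i o\<^sub>L A) ` J))"
    by (intro subsetD[OF closure_subset] span_base imageI i)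
  then obtain a where a: "supported_on J2 a" "(\<lambda>j. a j *\<^sub>R (bs j o\<^sub>L A)) sums (bs i o\<^sub>L A)"
    using basis unfolding schauder_basis_def by blast
  have "(\<lambda>j. blinfun_apply (a j *\<^sub>R (bs j o\<^sub>L A)) v) sums blinfun_apply (bs i o\<^sub>L A) v"
    by (rule bounded_linear.sums[OF blinfun.bounded_linear_left a(2)])
  moreover have "(\<lambda>j. blinfun_apply (a j *\<^sub>R (bs j o\<^sub>L A)) v) = (\<lambda>j. 0)"
  proof
    show "blinfun_apply (a j *\<^sub>R (bs j o\<^sub>L A)) v = 0" for j
      using zero a(1) by (cases "j \<in> J2") (simp_all add: supported_on_def blinfun.scaleR_left)
  qed
  ultimately show ?thesis
    by (simp add: sums_iff)
qed

text \<open>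
  A direction tangent to the constraints in \<open>J\<close> is corrected to a curve on which they all vanish. The
  constraints in \<open>J2\<close> have a surjective derivative at \<open>x0\<close>, so that they can be solved exactly, with a correction
  no larger than their defect on the line \<open>x0 + t *\<^sub>R d\<close>, which is of order \<open>o(t)\<close>. The remaining constraints
  follow because they are constant on the fibres of those in \<open>J2\<close>. No regularity of \<open>r\<close> in \<open>t\<close> is
  claimed: its values are chosen for each \<open>t\<close> separately.
\<close>

lemma CRC_plus_tangential_correction:
  fixes G :: "'a::banach \<Rightarrow> 'b" and g :: "nat \<Rightarrow> 'a \<Rightarrow> real"
  assumes C1: "class_C1 G" and g_eq: "g = (\<lambda>i. blinfun_apply (bs i) \<circ> G)"
    and CRC: "CRC_plus b g x0 V J J2" and J2: "J2 \<subseteq> J" and V: "x0 \<in> interior V"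
    and active: "\<And>i. i \<in> J \<Longrightarrow> g i x0 = 0"
    and tangent: "\<And>i. i \<in> J \<Longrightarrow> blinfun_apply (fderiv (g i) x0) d = 0"
  obtains r :: "real \<Rightarrow> 'a" where "((\<lambda>t. norm (r t) / t) \<longlongrightarrow> 0) (at_right 0)"
    "\<forall>\<^sub>F t in at_right 0. \<forall>i\<in>J. g i (x0 + t *\<^sub>R d + r t) = 0"
proof -
  have Dg: "fderiv (g i) x = bs i o\<^sub>L fderiv G x" for i x
    unfolding g_eq by (rule fderiv_coordinate[OF C1])
  have basis: "schauder_basis J2 (\<lambda>i. bs i o\<^sub>L fderiv G x)
      (closure (span ((\<lambda>i. bs i o\<^sub>L fderiv G x) ` J)))" if "x \<in> V" for x
    using CRC that unfolding CRC_plus_def grad_span_def Dg by blast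
  have x0V: "x0 \<in> V"
    using V interior_subset by blast
  have bess: "besselian J2 (\<lambda>i. bs i o\<^sub>L fderiv G x0)"
    using CRC unfolding CRC_plus_def Dg by blast
  have evaluation: "\<exists>e. \<forall>\<phi>\<in>closure (span ((\<lambda>i. bs i o\<^sub>L fderiv G x0) ` J)).
      basis_coeff J2 (\<lambda>i. bs i o\<^sub>L fderiv G x0) i \<phi> = blinfun_apply \<phi> e" if "i \<in> J2" for i
    using CRC that unfolding CRC_plus_def grad_span_def Dg by blast
  obtain C where C: "0 \<le> C"
    "\<And>w. \<exists>v. (\<forall>i\<in>J2. bs i (fderiv G x0 v) = bs i w) \<and> norm v \<le> C * norm w"
    by (rule besselian_rows_right_inverse[OF basis[OF x0V] bess evaluation]) blast+
  obtain Q :: "'b \<Rightarrow>\<^sub>L 'b" where Q: "\<And>i y. bs i (Q y) = (if i \<in> J then bs i y else 0)"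
    using coord_projection[of J] by blast
  obtain P :: "'b \<Rightarrow>\<^sub>L 'b" where P: "\<And>i y. bs i (P y) = (if i \<in> J2 then bs i y else 0)"
    using coord_projection[of J2] by blast
  have PQ: "P (Q y) = P y" for y
    by (rule coord_eqI) (use J2 in \<open>auto simp: P Q\<close>)
  have idem: "P (P y) = P y" for y
    by (rule coord_eqI) (simp add: P)
  define \<Phi> where "\<Phi> x = Q (G x)" for x
  define \<Phi>' where "\<Phi>' x = Q o\<^sub>L fderiv G x" for x
  have deriv: "(\<Phi> has_derivative blinfun_apply (\<Phi>' x)) (at x)" for x
    unfolding \<Phi>_def \<Phi>'_def blinfun_compose.rep_eq o_def
    by (rule bounded_linear.has_derivative[OF blinfun.bounded_linear_right
          class_C1_has_derivative[OF C1]])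
  have cont: "isCont \<Phi>' x0"
    unfolding \<Phi>'_def
    by (intro bounded_bilinear.continuous[OF bounded_bilinear_blinfun_compose]
        class_C1_continuous_fderiv[OF C1] continuous_const)
  have right_inv: "\<exists>v. P (\<Phi>' x0 v) = y \<and> norm v \<le> C * norm y" if y: "P y = y" for y
  proof -
    obtain v where v: "\<forall>i\<in>J2. bs i (fderiv G x0 v) = bs i y" "norm v \<le> C * norm y"
      using C(2) by blast
    have "bs i y = 0" if "i \<notin> J2" for i
      using P[of i y] y that by simp
    then have "P (\<Phi>' x0 v) = y"
      using v(1) by (intro coord_eqI) (auto simp: \<Phi>'_def PQ P)
    with v(2) show ?thesis
      by blast
  qed
  have ker: "\<forall>\<^sub>F x in nhds x0. \<forall>v. P (\<Phi>' x v) = 0 \<longrightarrow> \<Phi>' x v = 0"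
  proof -
    have "\<forall>\<^sub>F x in nhds x0. x \<in> interior V"
      using V by (simp add: eventually_nhds_in_open)
    then show ?thesis
    proof eventually_elim
      case (elim x)
      then have x: "x \<in> V"
        using interior_subset by blast
      show ?case
      proof (intro allI impI)
        fix v assume "P (\<Phi>' x v) = 0"
        then have "P (fderiv G x v) = 0"
          by (simp add: \<Phi>'_def PQ)
        then have "bs i (fderiv G x v) = 0" if "i \<in> J2" for i
          using P[of i "fderiv G x v"] that by (simp add: blinfun.zero_right)
        then have "bs i (fderiv G x v) = 0" if "i \<in> J" for i
          using row_vanishes_on_common_kernel[OF basis[OF x]] that by blast
        then show "\<Phi>' x v = 0"
          by (intro coord_eqI) (simp add: \<Phi>'_def Q blinfun.zero_right)
      qed
    qed
  qed
  obtain \<rho> where \<rho>: "0 < \<rho>"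
    "\<And>x. x \<in> ball x0 \<rho> \<Longrightarrow> P (\<Phi> x) = P (\<Phi> x0) \<Longrightarrow> \<Phi> x = \<Phi> x0"
    by (rule constant_rank_fibre[OF deriv cont idem C(1) right_inv ker]) blast+
  define H where "H x = P (\<Phi> x)" for x
  define H' where "H' x = P o\<^sub>L \<Phi>' x" for x
  have derivH: "(H has_derivative blinfun_apply (H' x)) (at x)" for x
    unfolding H_def H'_def blinfun_compose.rep_eq o_def
    by (rule bounded_linear.has_derivative[OF blinfun.bounded_linear_right deriv])
  have contH': "isCont H' x0"
    unfolding H'_def
    by (intro bounded_bilinear.continuous[OF bounded_bilinear_blinfun_compose] cont continuous_const)
  have W: "subspace {y. P y = y}"
    by (rule subspaceI) (auto simp: blinfun.bilinear_simps)
  have HW: "H x \<in> {y. P y = y}" for x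
    by (simp add: H_def idem)
  have H'_onto: "\<exists>v. H' x0 v = y \<and> norm v \<le> C * norm y" if "y \<in> {y. P y = y}" for y
    using right_inv that by (simp add: H'_def)
  obtain \<sigma> K where \<sigma>: "0 < \<sigma>" "0 \<le> K"
    "\<And>p. p \<in> ball x0 \<sigma> \<Longrightarrow> \<exists>q. H q = H x0 \<and> norm (q - p) \<le> K * norm (H p - H x0)"
    by (rule lyusternik_graves[OF derivH contH' W HW C(1) H'_onto]) blast+
  then obtain q where q: "\<And>p. p \<in> ball x0 \<sigma> \<Longrightarrow> H (q p) = H x0"
    "\<And>p. p \<in> ball x0 \<sigma> \<Longrightarrow> norm (q p - p) \<le> K * norm (H p - H x0)"
    by metis
  define r where "r t = q (x0 + t *\<^sub>R d) - (x0 + t *\<^sub>R d)" for t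
  have line: "((\<lambda>t. x0 + t *\<^sub>R d) \<longlongrightarrow> x0) (at_right 0)"
    by (rule tendsto_eq_rhs[of _ "x0 + 0 *\<^sub>R d"], intro tendsto_intros) simp
  have near: "\<forall>\<^sub>F t in at_right 0. x0 + t *\<^sub>R d \<in> ball x0 \<sigma>"
    using topological_tendstoD[OF line, of "ball x0 \<sigma>"] \<sigma>(1) by simp
  have pos: "\<forall>\<^sub>F t in at_right 0. 0 < (t :: real)"
    by (simp add: eventually_at_right_less)
  have slope: "((\<lambda>t. (H (x0 + t *\<^sub>R d) - H x0) /\<^sub>R t) \<longlongrightarrow> H' x0 d) (at_right 0)"
  proof (rule hadamard_derivative[OF derivH line pos])
    have "\<forall>\<^sub>F t in at_right 0. d = (x0 + t *\<^sub>R d - x0) /\<^sub>R t"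
      using pos by eventually_elim simp
    then show "((\<lambda>t. (x0 + t *\<^sub>R d - x0) /\<^sub>R t) \<longlongrightarrow> d) (at_right 0)"
      by (rule Lim_transform_eventually[OF tendsto_const])
  qed
  have "H' x0 d = 0"
    using tangent J2 by (intro coord_eqI) (auto simp: H'_def \<Phi>'_def PQ P Dg blinfun.zero_right)
  with slope have "((\<lambda>t. K * norm ((H (x0 + t *\<^sub>R d) - H x0) /\<^sub>R t)) \<longlongrightarrow> K * norm (0 :: 'b)) (at_right 0)"
    by (intro tendsto_intros) simp
  then have bound0: "((\<lambda>t. K * norm ((H (x0 + t *\<^sub>R d) - H x0) /\<^sub>R t)) \<longlongrightarrow> 0) (at_right 0)"
    by simp
  have little: "((\<lambda>t. norm (r t) / t) \<longlongrightarrow> 0) (at_right 0)"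
  proof (rule Lim_null_comparison[OF _ bound0])
    show "\<forall>\<^sub>F t in at_right 0.
        norm (norm (r t) / t) \<le> K * norm ((H (x0 + t *\<^sub>R d) - H x0) /\<^sub>R t)"
      using near pos
    proof eventually_elim
      case (elim t)
      have "norm (r t) / t \<le> K * norm (H (x0 + t *\<^sub>R d) - H x0) / t"
        using q(2)[OF elim(1)] elim(2) by (intro divide_right_mono) (simp_all add: r_def)
      with elim(2) show ?case
        by (simp add: divide_inverse mult_ac)
    qed
  qed
  have "((\<lambda>t. norm (r t) / t * t) \<longlongrightarrow> 0 * 0) (at_right 0)"
    by (intro tendsto_mult little tendsto_ident_at)
  moreover have "\<forall>\<^sub>F t in at_right 0. norm (r t) / t * t = norm (r t)"
    using pos by eventually_elim simp
  ultimately have "((\<lambda>t. norm (r t)) \<longlongrightarrow> 0 * 0) (at_right 0)"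
    by (rule Lim_transform_eventually)
  then have "((\<lambda>t. norm (r t)) \<longlongrightarrow> 0) (at_right 0)"
    by simp
  then have "(r \<longlongrightarrow> 0) (at_right 0)"
    by (rule tendsto_norm_zero_cancel)
  then have lim: "((\<lambda>t. x0 + t *\<^sub>R d + r t) \<longlongrightarrow> x0 + 0) (at_right 0)"
    by (intro tendsto_add line)
  have "\<forall>\<^sub>F t in at_right 0. x0 + t *\<^sub>R d + r t \<in> ball x0 \<rho>"
    using \<rho>(1) by (intro topological_tendstoD[OF lim]) simp_all
  then have "\<forall>\<^sub>F t in at_right 0. \<forall>i\<in>J. g i (x0 + t *\<^sub>R d + r t) = 0"
    using near
  proof eventually_elim
    case (elim t)
    have "H (x0 + t *\<^sub>R d + r t) = H x0"
      using q(1)[OF elim(2)] by (simp add: r_def)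
    then have "\<Phi> (x0 + t *\<^sub>R d + r t) = \<Phi> x0"
      using \<rho>(2)[OF elim(1)] by (simp add: H_def)
    then have "bs i (Q (G (x0 + t *\<^sub>R d + r t))) = bs i (Q (G x0))" for i
      by (simp add: \<Phi>_def)
    note same = this[unfolded Q]
    have "g i (x0 + t *\<^sub>R d + r t) = g i x0" if "i \<in> J" for i
      using same[of i] that by (simp add: g_eq)
    then show ?case
      using active by simp
  qed
  with little show thesis
    by (rule that)
qed

end

section \<open>The Abadie condition\<close>

theorem theorem7p4:
  fixes G :: "'a::banach \<Rightarrow> 'b::{real_inner, complete_space}"
    and b :: "nat \<Rightarrow> 'b"
    and bs :: "nat \<Rightarrow> 'b \<Rightarrow>\<^sub>L real"
    and g :: "nat \<Rightarrow> 'a \<Rightarrow> real"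
    and I0 I1 :: "nat set"
    and x0 :: 'a
  assumes basis: "schauder_basis UNIV b UNIV"
    and bessel: "besselian UNIV b"
    and hilbert: "hilbertian UNIV b"
    and biorth: "biorthogonal_functionals b bs"
    and index: "I0 \<union> I1 = UNIV" "I0 \<inter> I1 = {}"
    and C1: "class_C1 G"
    and g_eq: "g = (\<lambda>i. blinfun_apply (bs i) \<circ> G)"
    and x0: "x0 \<in> feasible_set g I0 I1"
    and rcrcq: "RCRCQ_plus b g I0 I1 x0"
    and inactive:
      "\<And>d r. d \<in> linearized_cone G (cone_K bs I0 I1) x0 \<Longrightarrow>
         ((\<lambda>t::real. norm (r t) / t) \<longlongrightarrow> 0) (at_right 0) \<Longrightarrow>
         \<exists>\<epsilon>0>0. \<epsilon>0 \<le> 1 \<and>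
           (\<forall>i\<in>I1 - active_dir g I1 x0 d. \<forall>t\<in>{0<..<\<epsilon>0}. g i (x0 + t *\<^sub>R d + r t) \<le> 0)"
  shows "linearized_cone G (cone_K bs I0 I1) x0 = tangent_cone (feasible_set g I0 I1) x0 \<and>
    (\<forall>d\<in>tangent_cone (feasible_set g I0 I1) x0.
       \<exists>r :: real \<Rightarrow> 'a. ((\<lambda>t. norm (r t) / t) \<longlongrightarrow> 0) (at_right 0) \<and>
         (\<forall>\<^sub>F t in at_right 0.
            (\<forall>i\<in>I0 \<union> active_dir g I1 x0 d. g i (x0 + t *\<^sub>R d + r t) = 0) \<and>
            (\<forall>l\<in>I1 - (I0 \<union> active_dir g I1 x0 d). g l (x0 + t *\<^sub>R d + r t) \<le> 0)))"
proof -
  interpret riesz_basis b bs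
    by unfold_locales (use biorth bessel hilbert in auto)
  let ?\<Gamma> = "linearized_cone G (cone_K bs I0 I1) x0"
  let ?T = "tangent_cone (feasible_set g I0 I1) x0"
  have G': "(G has_derivative blinfun_apply (fderiv G x0)) (at x0)"
    by (rule class_C1_has_derivative[OF C1])
  have Dg: "fderiv (g i) x = bs i o\<^sub>L fderiv G x" for i x
    unfolding g_eq by (rule fderiv_coordinate[OF C1])
  have T_sub: "?T \<subseteq> ?\<Gamma>"
  proof
    fix d assume "d \<in> ?T"
    then obtain xs t where xs: "\<And>k. xs k \<in> feasible_set g I0 I1"
      "filterlim t (at_right 0) sequentially" "\<And>k. t k > 0"
      "xs \<longlonglongrightarrow> x0" "(\<lambda>k. (xs k - x0) /\<^sub>R t k) \<longlonglongrightarrow> d"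
      unfolding tangent_cone_def by blast
    have "(\<lambda>k. (G (xs k) - G x0) /\<^sub>R t k) \<longlonglongrightarrow> fderiv G x0 d"
      by (rule hadamard_derivative[OF G' xs(4) _ xs(5)]) (simp add: xs(3))
    moreover have "(\<lambda>k. G (xs k)) \<longlonglongrightarrow> G x0"
      using has_derivative_continuous[OF G'] xs(4) by (rule isCont_tendsto_compose)
    moreover have "G (xs k) \<in> cone_K bs I0 I1" for k
      using xs(1)[of k] by (simp add: feasible_set_def cone_K_def g_eq)
    ultimately show "d \<in> ?\<Gamma>"
      unfolding linearized_cone_def tangent_cone_def using xs(2,3)
      by (auto intro!: exI[of _ "\<lambda>k. G (xs k)"] exI[of _ t])
  qed
  have curve: "\<exists>r :: real \<Rightarrow> 'a. ((\<lambda>t. norm (r t) / t) \<longlongrightarrow> 0) (at_right 0) \<and>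
      (\<forall>\<^sub>F t in at_right 0.
         (\<forall>i\<in>I0 \<union> active_dir g I1 x0 d. g i (x0 + t *\<^sub>R d + r t) = 0) \<and>
         (\<forall>l\<in>I1 - (I0 \<union> active_dir g I1 x0 d). g l (x0 + t *\<^sub>R d + r t) \<le> 0))"
    if d: "d \<in> ?\<Gamma>" for d
  proof -
    define J where "J = I0 \<union> active_dir g I1 x0 d"
    obtain V where V: "x0 \<in> interior V"
      "\<And>J. I0 \<subseteq> J \<Longrightarrow> J \<subseteq> I0 \<union> active g I1 x0 \<Longrightarrow> \<exists>J2\<subseteq>J. CRC_plus b g x0 V J J2"
      using rcrcq unfolding RCRCQ_plus_def by blast
    have "J \<subseteq> I0 \<union> active g I1 x0" "I0 \<subseteq> J"
      by (auto simp: J_def active_dir_def)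
    then obtain J2 where J2: "J2 \<subseteq> J" "CRC_plus b g x0 V J J2"
      using V(2) by blast
    \<comment> \<open>On equality constraints \<open>cone_K\<close> is a linear subspace, so differences of its points, and their limits, stay in it.\<close>
    have tangent0: "blinfun_apply (fderiv (g i) x0) d = 0" if i: "i \<in> I0" for i
    proof -
      obtain ys t where ys: "\<And>k. ys k \<in> cone_K bs I0 I1"
        "(\<lambda>k. (ys k - G x0) /\<^sub>R t k) \<longlonglongrightarrow> fderiv G x0 d"
        using d unfolding linearized_cone_def tangent_cone_def by blast
      have "(\<lambda>k. bs i ((ys k - G x0) /\<^sub>R t k)) \<longlonglongrightarrow> bs i (fderiv G x0 d)"
        by (intro tendsto_intros ys(2))
      moreover have "bs i ((ys k - G x0) /\<^sub>R t k) = 0" for k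
        using ys(1)[of k] x0 i
        by (simp add: cone_K_def feasible_set_def g_eq blinfun.bilinear_simps)
      ultimately show ?thesis
        by (simp add: Dg LIMSEQ_const_iff)
    qed
    have tangent: "blinfun_apply (fderiv (g i) x0) d = 0" if "i \<in> J" for i
      using that tangent0 by (auto simp: J_def active_dir_def)
    have vanish: "g i x0 = 0" if "i \<in> J" for i
      using that x0 by (auto simp: J_def active_dir_def active_def feasible_set_def)
    obtain r where r: "((\<lambda>t. norm (r t) / t) \<longlongrightarrow> 0) (at_right 0)"
      "\<forall>\<^sub>F t in at_right 0. \<forall>i\<in>J. g i (x0 + t *\<^sub>R d + r t) = 0"
      by (rule CRC_plus_tangential_correction[OF C1 g_eq J2(2,1) V(1) vanish tangent])
    obtain \<epsilon>0 where \<epsilon>0: "\<epsilon>0 > 0"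
      "\<forall>i\<in>I1 - active_dir g I1 x0 d. \<forall>t\<in>{0<..<\<epsilon>0}. g i (x0 + t *\<^sub>R d + r t) \<le> 0"
      using inactive[OF d r(1)] by blast
    have "\<forall>\<^sub>F t in at_right 0. t \<in> {0<..<\<epsilon>0}"
      using \<epsilon>0(1) by (rule eventually_at_right_real)
    with r(2) have "\<forall>\<^sub>F t in at_right 0. (\<forall>i\<in>J. g i (x0 + t *\<^sub>R d + r t) = 0) \<and>
        (\<forall>l\<in>I1 - J. g l (x0 + t *\<^sub>R d + r t) \<le> 0)"
      by eventually_elim (use \<epsilon>0(2) in \<open>auto simp: J_def\<close>)
    with r(1) show ?thesis
      unfolding J_def by blast
  qed
  have "?\<Gamma> \<subseteq> ?T"
  proof
    fix d assume "d \<in> ?\<Gamma>"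
    from curve[OF this] obtain r :: "real \<Rightarrow> 'a" where
      r: "((\<lambda>t. norm (r t) / t) \<longlongrightarrow> 0) (at_right 0)"
      and ev: "\<forall>\<^sub>F t in at_right 0.
         (\<forall>i\<in>I0 \<union> active_dir g I1 x0 d. g i (x0 + t *\<^sub>R d + r t) = 0) \<and>
         (\<forall>l\<in>I1 - (I0 \<union> active_dir g I1 x0 d). g l (x0 + t *\<^sub>R d + r t) \<le> 0)"
      by blast
    from ev have "\<forall>\<^sub>F t in at_right 0. x0 + t *\<^sub>R d + r t \<in> feasible_set g I0 I1"
      by (rule eventually_mono) (force simp: feasible_set_def)
    then obtain \<delta> where \<delta>: "0 < \<delta>"
      "\<And>t. 0 < t \<Longrightarrow> t < \<delta> \<Longrightarrow> x0 + t *\<^sub>R d + r t \<in> feasible_set g I0 I1"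
      unfolding eventually_at_right_field by auto
    define t where "t k = \<delta> / 2 * inverse (real (Suc k))" for k
    have t: "0 < t k" "t k < \<delta>" for k
    proof -
      show "0 < t k"
        using \<delta>(1) by (simp add: t_def)
      have "inverse (real (Suc k)) \<le> 1"
        by (simp add: inverse_le_1_iff)
      then have "t k \<le> \<delta> / 2 * 1"
        unfolding t_def using \<delta>(1) by (intro mult_left_mono) auto
      then show "t k < \<delta>"
        using \<delta>(1) by linarith
    qed
    have "t \<longlonglongrightarrow> \<delta> / 2 * 0"
      unfolding t_def by (intro tendsto_intros LIMSEQ_inverse_real_of_nat)
    then have t0: "t \<longlonglongrightarrow> 0"
      by simp
    have tr: "filterlim t (at_right 0) sequentially"
      using t0 t(1) less_imp_neq[OF t(1)] by (simp add: filterlim_at)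
    have rt: "(\<lambda>k. norm (r (t k)) / t k) \<longlonglongrightarrow> 0"
      by (rule filterlim_compose[OF r tr])
    have "(\<lambda>k. r (t k) /\<^sub>R t k) \<longlonglongrightarrow> 0"
      by (rule tendsto_norm_zero_cancel)
        (use rt t in \<open>simp add: divide_inverse mult.commute less_imp_le\<close>)
    then have "(\<lambda>k. d + r (t k) /\<^sub>R t k) \<longlonglongrightarrow> d + 0"
      by (intro tendsto_intros)
    moreover have "(x0 + t k *\<^sub>R d + r (t k) - x0) /\<^sub>R t k = d + r (t k) /\<^sub>R t k" for k
      using t(1)[of k] by (simp add: scaleR_add_right)
    ultimately have quot: "(\<lambda>k. (x0 + t k *\<^sub>R d + r (t k) - x0) /\<^sub>R t k) \<longlonglongrightarrow> d"
      by simp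
    have "(\<lambda>k. x0 + t k *\<^sub>R ((x0 + t k *\<^sub>R d + r (t k) - x0) /\<^sub>R t k)) \<longlonglongrightarrow> x0 + 0 *\<^sub>R d"
      by (intro tendsto_intros t0 quot)
    moreover have "x0 + t k *\<^sub>R ((x0 + t k *\<^sub>R d + r (t k) - x0) /\<^sub>R t k) = x0 + t k *\<^sub>R d + r (t k)" for k
      using t(1)[of k] by simp
    ultimately have lim: "(\<lambda>k. x0 + t k *\<^sub>R d + r (t k)) \<longlonglongrightarrow> x0"
      by (simp only: scaleR_zero_left add_0_right)
    have "\<forall>k. x0 + t k *\<^sub>R d + r (t k) \<in> feasible_set g I0 I1" "\<forall>k. 0 < t k"
      using \<delta>(2) t by simp_all
    with tr lim quot show "d \<in> ?T"
      unfolding tangent_cone_def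
      by (intro CollectI exI[of _ "\<lambda>k. x0 + t k *\<^sub>R d + r (t k)"] exI[of _ t] conjI)
  qed
  then have eq: "?\<Gamma> = ?T"
    using T_sub by (rule subset_antisym)
  moreover have "d \<in> ?\<Gamma>" if "d \<in> ?T" for d
    using T_sub that by (rule subsetD)
  ultimately show ?thesis
    by (intro conjI ballI curve)
qed

end
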